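(* Let $V$ be a set of size $n$ and let $X=(V,E,T)$, where $E$ is the set of all $2$-element subsets of $V$ and $T$ is the set of all $3$-element subsets of $V$. For every continuous well-behaved $f:X\to\mathbb{R}^2$ and for every probability distribution $p$ on $V$, there is a point $r\in\mathbb{R}^2$ so that $$\sum_{t\in T:\ r\in f(t)} p(t)\ \ge\ \frac{1}{13}-\frac{3}{13(n-1)}.$$
   Context: Weights. The distribution $p$ on $V$ is extended to $E$ (edges) and $T$ (triangles) by $p(\{v_1,v_2\})=\frac{p(v_1)+p(v_2)}{\binom{n-1}{1}}$ and $p(\{v_1,v_2,v_3\})=\frac{p(v_1)+p(v_2)+p(v_3)}{\binom{n-1}{2}}$. Continuous maps. For a continuous map $f:X\to\mathbb{R}^2$, the image $f(v)$ of a vertex is a point in $\mathbb{R}^2$, the image $f(e)$ of an edge $e=\{v_1,v_2\}$ is a continuous path between $f(v_1)$ and $f(v_2)$ that is topologically an interval, and the image $f(t)$ of a triangle $t$ is topologically a triangle; the edges of $f(t)$ are the images $f(e)$ of the three edges $e\subset t$. Triangulations. Let $B$ be the Euclidean unit ball in the plane and $B/2$ the concentric ball of radius $1/2$. It is assumed, without loss of generality, that $f(e)\subset B/2$ for all $e\in E$. A triangulation $X^*=(V^*,E^*,T^* )$ of $B$ consists of a set $V^*$ of points in $B$ (vertices), a set $E^*$ of line segments connecting points in $V^*$ (edges), and the set $T^*$ of triangles defined by $E^*$, so that the triangles (almost) form a partition of $B$. Well-behaved maps. The map $f$ is well-behaved if there is a finite triangulation $X^*=(V^*,E^*,T^* )$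 of $B$ with the following properties. (Intuitively, $V^*$ is a set of dense and generic points, with edges short enough and triangles small enough that each of them sees at most one complex region.) (1) $f(v)\notin e^*$ and $v^*\notin f(e)$ for all $v\in V$, $e\in E$, $v^*\in V^*$, $e^*\in E^*$. (2) For every $v\in V$ there is a triangle $t^*_v\in T^*$ so that $f(v)\in t^*_v$; for every $u\ne v$ in $V$, the point $f(u)$ is not in $t^*_v$. (3) For every $e\in E$ and $t^*\in T^*$, if $f(e)$ has one end inside $t^*$ and one end outside $t^*$, then $f(e)$ intersects exactly one edge of $t^*$. (4) For every $e^*\in E^*$ and $t\in T$, if $e^*$ has one end inside $f(t)$ and one end outside $f(t)$, then $e^*$ intersects exactly one edge of $f(t)$. (5) For $v\in V$ and $e\in E$, if $f(e)\cap t^*_v\neq\emptyset$ then $v\in e$. (6) For every $e^*\in E^*$ and $t\in T$, if $e^*$ does not have one end inside $f(t)$ and one end outside $f(t)$, then $e^*$ intersects at most two edges of $f(t)$. (7) For every $v\in V$ and $e^*\in E^*$ so that $e^*$ is not contained in $t^*_v$, there is at most one $u\in V$ so that $e^*\cap f(\{v,u\})\ne\emptyset$. (8) For every $e\in E$ and $t^*\in T^*$, the path $f(e)$ intersects at most two edges of $t^*$. *)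

theory Defs
  imports "HOL-Analysis.Analysis" "HOL-Probability.Probability_Mass_Function"
begin

text \<open>
  The vertex set \<open>V\<close> is a finite type \<open>'v\<close>.  The complex \<open>X\<close> is realised geometrically in
  \<open>real ^ 'v\<close>: the vertex \<open>v\<close> is the unit vector \<open>axis v 1\<close>, and a set of vertices spans the
  convex hull of the corresponding unit vectors.
\<close>

definition vert :: "'v::finite \<Rightarrow> real ^ 'v" where
  "vert v = axis v 1"

definition cell :: "'v::finite set \<Rightarrow> (real ^ 'v) set" where
  "cell s = convex hull (vert ` s)"

definition E :: "'v::finite set set" where
  "E = {e. card e = 2}"

definition T :: "'v::finite set set" where
  "T = {t. card t = 3}"

definition X :: "(real ^ 'v::finite) set" where
  "X = range vert \<union> (\<Union>e\<in>E. cell e) \<union> (\<Union>t\<in>T. cell t)"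

text \<open>
  A single formula covers vertices, edges and triangles: the denominator
  is \<open>n - 1 choose (card s - 1)\<close>.
\<close>

definition weight :: "'v::finite pmf \<Rightarrow> 'v set \<Rightarrow> real" where
  "weight p s = (\<Sum>v\<in>s. pmf p v) / real ((CARD('v) - 1) choose (card s - 1))"

lemma weight_edge:
  fixes p :: "'v::finite pmf"
  assumes "v1 \<noteq> v2"
  shows "weight p {v1, v2} = (pmf p v1 + pmf p v2) / real ((CARD('v) - 1) choose 1)"
  using assms by (simp add: weight_def)

lemma weight_triangle:
  fixes p :: "'v::finite pmf"
  assumes "v1 \<noteq> v2" "v1 \<noteq> v3" "v2 \<noteq> v3"
  shows "weight p {v1, v2, v3}
    = (pmf p v1 + pmf p v2 + pmf p v3) / real ((CARD('v) - 1) choose 2)"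
  using assms by (simp add: weight_def add.assoc numeral_2_eq_2)

text \<open>
  The image of every edge is topologically an interval with the images of its vertices as
  endpoints, and the image of every triangle is topologically a triangle whose edges are the images
  of the edges.  The condition concerns the images only: the homeomorphism \<open>h\<close> may differ
  from \<open>f\<close>, as long as it maps every face onto the image of that face.
\<close>

definition simplicial_images :: "(real ^ 'v::finite \<Rightarrow> real ^ 2) \<Rightarrow> bool" where
  "simplicial_images f \<longleftrightarrow>
     (\<forall>s\<in>E \<union> T. \<exists>h k. homeomorphism (cell s) (f ` cell s) h k \<and>
        (\<forall>s'\<subseteq>s. h ` cell s' = f ` cell s'))"

text \<open>
  Triangulations \<open>(Vs, Es, Ts)\<close> of the unit ball.  Finitely many straight triangles inside the ball
  cannot cover it, so ``almost a partition'' means: the triangles have disjoint interiors, they lie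
  in the ball, and they cover at least the concentric ball of radius \<open>1/2\<close>, which contains the
  image of the complex.  Triangles are not required to meet face to face: a side of one triangle may
  be subdivided on its other side.  Face-to-face triangulations are a special case, but they admit
  well-behaved maps for at most seven vertices only: all paths from \<open>f(v)\<close> to the other vertices
  leave the triangle around \<open>f(v)\<close> through its three neighbours, and each further side of a neighbour
  may meet only one of these paths.
\<close>

definition ball_triangulation ::
    "(real ^ 2) set \<Rightarrow> (real ^ 2) set set \<Rightarrow> (real ^ 2) set set \<Rightarrow> bool" where
  "ball_triangulation Vs Es Ts \<longleftrightarrow>
     finite Vs \<and> Vs \<subseteq> cball 0 1 \<and>
     (\<forall>es\<in>Es. \<exists>a\<in>Vs. \<exists>b\<in>Vs. a \<noteq> b \<and> es = closed_segment a b) \<and>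
     (\<forall>ts\<in>Ts. 2 simplex ts \<and> (\<forall>s. s facet_of ts \<longrightarrow> s \<in> Es)) \<and>
     (\<forall>ts\<in>Ts. \<forall>ts'\<in>Ts. ts \<noteq> ts' \<longrightarrow> interior ts \<inter> interior ts' = {}) \<and>
     cball 0 (1/2) \<subseteq> \<Union>Ts \<and> \<Union>Ts \<subseteq> cball 0 1"

text \<open>
  ``One end inside and one end outside'', for a segment and for the image of an edge of \<open>X\<close>.  Being
  inside is plain membership: for well-behaved maps the ends are never on the boundary of the
  triangle in question.
\<close>

definition segment_splits :: "(real ^ 2) set \<Rightarrow> (real ^ 2) set \<Rightarrow> bool" where
  "segment_splits es A \<longleftrightarrow> (\<exists>a b. es = closed_segment a b \<and> a \<in> A \<and> b \<notin> A)"

definition edge_splits ::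
    "(real ^ 'v::finite \<Rightarrow> real ^ 2) \<Rightarrow> 'v set \<Rightarrow> (real ^ 2) set \<Rightarrow> bool" where
  "edge_splits f e A \<longleftrightarrow> (\<exists>u v. e = {u, v} \<and> f (vert u) \<in> A \<and> f (vert v) \<notin> A)"

definition sides_met ::
    "(real ^ 'v::finite \<Rightarrow> real ^ 2) \<Rightarrow> 'v set \<Rightarrow> (real ^ 2) set \<Rightarrow> (real ^ 2) set set" where
  "sides_met f e ts = {s. s facet_of ts \<and> f ` cell e \<inter> s \<noteq> {}}"

definition edges_met ::
    "(real ^ 'v::finite \<Rightarrow> real ^ 2) \<Rightarrow> (real ^ 2) set \<Rightarrow> 'v set \<Rightarrow> 'v set set" where
  "edges_met f es t = {e\<in>E. e \<subseteq> t \<and> es \<inter> f ` cell e \<noteq> {}}"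

text \<open>The function \<open>tv\<close> assigns to a vertex \<open>v\<close> the triangle containing \<open>f(v)\<close>.\<close>

definition well_behaved :: "(real ^ 'v::finite \<Rightarrow> real ^ 2) \<Rightarrow> bool" where
  "well_behaved f \<longleftrightarrow> (\<exists>Vs Es Ts tv.
     ball_triangulation Vs Es Ts \<and>
     (\<forall>v. \<forall>es\<in>Es. f (vert v) \<notin> es) \<and> (\<forall>e\<in>E. \<forall>vs\<in>Vs. vs \<notin> f ` cell e) \<and>
     (\<forall>v. tv v \<in> Ts \<and> f (vert v) \<in> tv v \<and> (\<forall>u. u \<noteq> v \<longrightarrow> f (vert u) \<notin> tv v)) \<and>
     (\<forall>e\<in>E. \<forall>ts\<in>Ts. edge_splits f e ts \<longrightarrow> card (sides_met f e ts) = 1) \<and>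
     (\<forall>es\<in>Es. \<forall>t\<in>T. segment_splits es (f ` cell t) \<longrightarrow> card (edges_met f es t) = 1) \<and>
     (\<forall>v. \<forall>e\<in>E. f ` cell e \<inter> tv v \<noteq> {} \<longrightarrow> v \<in> e) \<and>
     (\<forall>es\<in>Es. \<forall>t\<in>T. \<not> segment_splits es (f ` cell t) \<longrightarrow> card (edges_met f es t) \<le> 2) \<and>
     (\<forall>v. \<forall>es\<in>Es. \<not> es \<subseteq> tv v \<longrightarrow>
        (\<exists>\<^sub>\<le>\<^sub>1u. u \<noteq> v \<and> es \<inter> f ` cell {v, u} \<noteq> {})) \<and>
     (\<forall>e\<in>E. \<forall>ts\<in>Ts. card (sides_met f e ts) \<le> 2))"

end

theory Submission
  imports Defs "HOL-Complex_Analysis.Winding_Numbers"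
begin

text \<open>
  Identify the plane with the complex numbers and look at the drawing from a point \<open>r\<close> off the
  edges.  Following the path \<open>f(ab)\<close>, the line of sight from \<open>r\<close> turns by some real number of full
  turns, the real part of the winding number of that path.  Around a triangle \<open>abc\<close> the three turns
  add up to \<open>0\<close>, \<open>1\<close> or \<open>-1\<close>, because the boundary is a simple closed curve, and to \<open>0\<close> if \<open>r\<close> is
  not in \<open>f(abc)\<close>, because that set is simply connected.

  So if \<open>r\<close> lies in few triangles, the directions in which \<open>r\<close> sees the vertices can be lifted to the
  real line almost consistently, and they have a mean in \<open>\<real>/\<int>\<close>: start at a vertex \<open>b\<close>, follow the
  edges to all \<open>v\<close>, and average with nearly uniform weights.  Starting at \<open>a\<close> instead changes this mean
  \<open>direction b r\<close>, modulo \<open>1\<close>, by at most about the proportion of those \<open>v\<close> for which \<open>r\<close> is in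
  \<open>f(abv)\<close> (\<open>circ_direction_diff_le\<close>).  Away from \<open>f(b)\<close>, it jumps only when \<open>r\<close> crosses an edge at
  \<open>b\<close>.  Two edges with a common vertex meet nowhere else, so only one edge at \<open>b\<close> is crossed at a
  time, and the jump is at most \<open>1/(n - 1)\<close> (\<open>direction_local_oscillation\<close>).

  Suppose that every \<open>r\<close> has a vertex \<open>a(r)\<close> such that \<open>r\<close> lies in few of the triangles at \<open>a(r)\<close>.
  Then \<open>direction (a(r)) r\<close> varies by less than one third of a turn near any point
  (\<open>selection_close\<close>), so smoothing the corresponding unit vectors by a partition of unity gives a
  continuous vector field without zeros.  Far away it points towards the drawing
  (\<open>direction_far\<close>).  That contradicts Brouwer's fixed point theorem (\<open>no_circle_selection\<close>).
  Hence some \<open>r\<close> lies in many of the triangles at every single vertex (\<open>deep_point\<close>).  The weight of a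
  set of triangles is the mean over \<open>p\<close> of the proportion of triangles at a vertex that belong to
  the set (\<open>sum_weight_eq\<close>), so this bounds the sum in the theorem for every \<open>p\<close> at once.

  The tolerance \<open>1/3\<close> leaves room for the bound \<open>1/13 - 3/(13(n - 1))\<close> as soon as \<open>n \<ge> 5\<close>
  (\<open>density_arith\<close>); for smaller \<open>n\<close> this bound is not positive.
\<close>

section \<open>Distances on the circle of reals modulo one\<close>

text \<open>The distance to the nearest integer, that is, the quotient norm on \<open>\<real>/\<int>\<close>.\<close>

definition circ :: "real \<Rightarrow> real" where
  "circ x = \<bar>x - of_int (round x)\<bar>"

lemma circ_nonneg [simp]: "0 \<le> circ x"
  by (simp add: circ_def)

lemma circ_le_dist_int: "circ x \<le> \<bar>x - of_int k\<bar>"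
  unfolding circ_def by (rule round_diff_minimal)

lemma circ_le_abs: "circ x \<le> \<bar>x\<bar>"
  using circ_le_dist_int[of x 0] by simp

lemma circ_triangle: "circ (x + y) \<le> circ x + circ y"
  using circ_le_dist_int[of "x + y" "round x + round y"] unfolding circ_def by simp

lemma circ_minus: "circ (- x) = circ x"
proof -
  have "circ (- y) \<le> circ y" for y
    using circ_le_dist_int[of "- y" "- round y"] unfolding circ_def by simp
  from this[of x] this[of "- x"] show ?thesis by simp
qed

lemma circ_diff_commute: "circ (x - y) = circ (y - x)"
  using circ_minus[of "x - y"] by simp

lemma circ_triangle_diff: "circ (x - z) \<le> circ (x - y) + circ (y - z)"
  using circ_triangle[of "x - y" "y - z"] by simp

lemma circ_add_int: "k \<in> \<int> \<Longrightarrow> circ (x + k) = circ x"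
proof -
  have le: "circ (y + of_int j) \<le> circ y" for y j
    using circ_le_dist_int[of "y + of_int j" "round y + j"] unfolding circ_def by simp
  assume "k \<in> \<int>"
  then obtain j where k: "k = of_int j" by (auto elim: Ints_cases)
  have "circ (x + of_int j) \<le> circ x" by (rule le)
  moreover have "circ x \<le> circ (x + of_int j)" using le[of "x + of_int j" "- j"] by simp
  ultimately show ?thesis unfolding k by simp
qed

lemma cos_circ: "cos (2 * pi * x) = cos (2 * pi * circ x)"
proof -
  have "cos (2 * pi * x) = cos (2 * pi * (x - of_int (round x)) + 2 * pi * of_int (round x))"
    by (simp add: algebra_simps)
  also have "\<dots> = cos (2 * pi * (x - of_int (round x)))"
    by (simp add: cos_add sin_int_2pin cos_int_2pin)
  also have "\<dots> = cos \<bar>2 * pi * (x - of_int (round x))\<bar>"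
    by (simp only: cos_abs_real)
  finally show ?thesis by (simp add: circ_def abs_mult)
qed

lemma cos_pos_if_circ_less: "circ x < 1/4 \<Longrightarrow> 0 < cos (2 * pi * x)"
proof -
  assume "circ x < 1/4"
  then have "2 * pi * circ x < pi / 2" by simp
  moreover have "0 \<le> 2 * pi * circ x" by simp
  ultimately show ?thesis
    unfolding cos_circ[of x] using pi_gt_zero by (intro cos_gt_zero_pi) linarith+
qed

lemma cis_eq_iff_diff_int: "cis (2 * pi * x) = cis (2 * pi * y) \<Longrightarrow> x - y \<in> \<int>"
proof -
  assume "cis (2 * pi * x) = cis (2 * pi * y)"
  then have "cis (2 * pi * (x - y)) = 1"
    by (simp add: right_diff_distrib flip: cis_divide)
  then have "cos (2 * pi * (x - y)) = 1" by (simp add: complex_eq_iff)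
  then obtain n where "2 * pi * (x - y) = of_int n * 2 * pi" by (auto simp: cos_one_2pi_int)
  then have "x - y = of_int n" by simp
  then show ?thesis by simp
qed

text \<open>
  Points of the circle that are pairwise less than a third of a turn apart lie in an arc of less than
  a third of a turn, hence in an open half plane.  Three equally spaced points show that the constant
  is the best possible.
\<close>
lemma positive_combination_nonzero:
  fixes z c :: "'i \<Rightarrow> real"
  assumes fin: "finite S" and nonneg: "\<And>s. s \<in> S \<Longrightarrow> 0 \<le> c s"
    and pos: "s0 \<in> S" "0 < c s0"
    and close: "\<And>s t. s \<in> S \<Longrightarrow> t \<in> S \<Longrightarrow> 0 < c s \<Longrightarrow> 0 < c t \<Longrightarrow> circ (z s - z t) < 1/3"
  shows "(\<Sum>s\<in>S. of_real (c s) * cis (2 * pi * z s)) \<noteq> 0"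
proof
  assume zero: "(\<Sum>s\<in>S. of_real (c s) * cis (2 * pi * z s)) = 0"
  define P where "P = {s \<in> S. 0 < c s}"
  define y where "y s = (z s - z s0) - of_int (round (z s - z s0))" for s
  have P: "finite P" "s0 \<in> P" using fin pos by (auto simp: P_def)
  \<comment> \<open>\<open>y\<close> lifts the circle to the line around \<open>z s0\<close>.  Two lifts differ by less than \<open>2/3\<close>, and
    by less than \<open>1/3\<close> modulo \<open>1\<close>, so no integer other than \<open>0\<close> can intervene.\<close>
  have y_abs: "\<bar>y s\<bar> < 1/3" if "s \<in> P" for s
    using close[of s s0] that P unfolding y_def circ_def P_def by auto
  have y_close: "\<bar>y s - y t\<bar> < 1/3" if "s \<in> P" "t \<in> P" for s t
  proof -
    have "circ (y s - y t) = circ ((z s - z t) + of_int (round (z t - z s0) - round (z s - z s0)))"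
      unfolding y_def by (rule arg_cong[where f = circ]) simp
    also have "\<dots> = circ (z s - z t)" by (intro circ_add_int) simp
    also have "\<dots> < 1/3" using close that by (auto simp: P_def)
    finally have d: "\<bar>y s - y t - of_int (round (y s - y t))\<bar> < 1/3" unfolding circ_def .
    with y_abs[OF that(1)] y_abs[OF that(2)] have "\<bar>real_of_int (round (y s - y t))\<bar> < 1"
      by linarith
    then have "round (y s - y t) = 0" by linarith
    with d show ?thesis by simp
  qed
  define lo hi where "lo = Min (y ` P)" and "hi = Max (y ` P)"
  have "lo \<in> y ` P" "hi \<in> y ` P" unfolding lo_def hi_def using P by (auto intro!: Min_in Max_in)
  then obtain s t where "s \<in> P" "t \<in> P" "lo = y s" "hi = y t" by blast
  then have width: "hi - lo < 1/3" using y_close[of t s] by linarith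
  have range: "lo \<le> y s" "y s \<le> hi" if "s \<in> P" for s
    unfolding lo_def hi_def using P that by auto
  define m where "m = (lo + hi) / 2"
  have "Re ((\<Sum>s\<in>S. of_real (c s) * cis (2 * pi * z s)) * cis (- (2 * pi * (z s0 + m))))
      = (\<Sum>s\<in>S. c s * cos (2 * pi * (z s - z s0 - m)))"
    by (simp add: sum_distrib_right mult.assoc cis_mult algebra_simps)
  also have "\<dots> = (\<Sum>s\<in>P. c s * cos (2 * pi * (z s - z s0 - m)))"
    by (rule sum.mono_neutral_right) (use fin nonneg in \<open>force simp: P_def\<close>)+
  also have "\<dots> > 0"
  proof (rule sum_pos)
    fix s assume s: "s \<in> P"
    have "circ (z s - z s0 - m) \<le> \<bar>z s - z s0 - m - of_int (round (z s - z s0))\<bar>"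
      by (rule circ_le_dist_int)
    also have "\<dots> = \<bar>y s - m\<bar>" by (simp add: y_def)
    also have "\<dots> < 1/4" using range[OF s] width unfolding m_def abs_less_iff
      by (simp add: field_simps)
    finally show "0 < c s * cos (2 * pi * (z s - z s0 - m))"
      using s by (intro mult_pos_pos cos_pos_if_circ_less) (auto simp: P_def)
  qed (use P in auto)
  finally show False using zero by simp
qed

section \<open>Nearly continuous choices of a direction\<close>

text \<open>
  A field without zeros could be normalised to a map from the ball to its boundary sphere, and by
  Brouwer's theorem it would have a fixed point.  At that point the field would point outwards.
\<close>
lemma inward_field_has_zero:
  fixes F :: "'a::euclidean_space \<Rightarrow> 'a"
  assumes "0 < R" "continuous_on (cball 0 R) F"
    and inward: "\<And>x. norm x = R \<Longrightarrow> F x \<bullet> x < 0"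
  shows "\<exists>x\<in>cball 0 R. F x = 0"
proof (rule ccontr)
  assume *: "\<not> (\<exists>x\<in>cball 0 R. F x = 0)"
  have "continuous_on (cball 0 R) (\<lambda>x. R *\<^sub>R sgn (F x))"
    unfolding sgn_div_norm using assms * by (intro continuous_intros) auto
  moreover have "(\<lambda>x. R *\<^sub>R sgn (F x)) \<in> cball 0 R \<rightarrow> cball 0 R"
    using \<open>0 < R\<close> by (auto simp: norm_sgn)
  ultimately obtain x where x: "x \<in> cball 0 R" "R *\<^sub>R sgn (F x) = x"
    using brouwer_ball[OF \<open>0 < R\<close>] by metis
  then have Fx: "F x \<noteq> 0" using * by auto
  have "norm x = norm (R *\<^sub>R sgn (F x))" by (simp add: x)
  also have "\<dots> = R" using Fx \<open>0 < R\<close> by (simp add: norm_sgn)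
  finally have "F x \<bullet> x < 0" by (rule inward)
  also have "F x \<bullet> x = R * norm (F x)"
  proof -
    have "F x \<bullet> x = F x \<bullet> (R *\<^sub>R sgn (F x))" by (simp add: x(2))
    then show ?thesis
      using Fx by (simp add: sgn_div_norm dot_square_norm power2_eq_square)
  qed
  finally show False using \<open>0 < R\<close> by (simp add: mult_less_0_iff)
qed

text \<open>
  The map \<open>z\<close> chooses a direction at every point outside a set \<open>K\<close> with empty
  interior.  It may be
  discontinuous, but it must not oscillate by a third of a turn.  Averaging the chosen unit vectors
  over a fine net turns it into a genuine vector field, which cannot point inwards on a large
  sphere without vanishing somewhere.
\<close>
lemma no_circle_selection:
  fixes z :: "complex \<Rightarrow> real"
  assumes K: "interior K = {}"
    and close: "\<And>x. \<exists>d>0. \<forall>r\<in>ball x d - K. \<forall>r'\<in>ball x d - K. circ (z r - z r') < 1/3"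
    and "0 < R"
    and far: "\<And>x r. norm x = R \<Longrightarrow> r \<notin> K \<Longrightarrow> dist x r < 1 \<Longrightarrow> circ (z r - Arg (- x) / (2 * pi)) < 1/4"
  shows False
proof -
  define good where "good U \<longleftrightarrow> (\<forall>r\<in>U - K. \<forall>r'\<in>U - K. circ (z r - z r') < 1/3)" for U
  define C where "C = {ball x d | x d. 0 < d \<and> good (ball x d)}"
  have cover: "cball 0 (R + 1) \<subseteq> \<Union>C"
  proof
    fix x assume "x \<in> cball (0::complex) (R + 1)"
    obtain d where "d > 0" "good (ball x d)" using close[of x] by (auto simp: good_def)
    then show "x \<in> \<Union>C" unfolding C_def by (intro UnionI[of "ball x d"]) auto
  qed
  have "C \<noteq> {}" using cover \<open>0 < R\<close> by force
  moreover have "open B" if "B \<in> C" for B using that by (auto simp: C_def)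
  ultimately obtain e where e: "0 < e" "\<And>A. A \<subseteq> cball 0 (R + 1) \<Longrightarrow> diameter A < e \<Longrightarrow> \<exists>B\<in>C. A \<subseteq> B"
    using Lebesgue_number_lemma[OF compact_cball _ cover] by blast
  define d where "d = min 1 (e / 3)"
  have d: "0 < d" "d \<le> 1" "2 * d < e" using e(1) by (auto simp: d_def)
  have "cball 0 R \<subseteq> (\<Union>s\<in>-K. ball s d)"
  proof
    fix x :: complex
    have "\<not> ball x d \<subseteq> K" using K d(1) by (metis centre_in_ball empty_iff interior_maximal open_ball subsetD)
    then show "x \<in> (\<Union>s\<in>-K. ball s d)" by (auto simp: dist_commute)
  qed
  then obtain S where S: "S \<subseteq> -K" "finite S" "cball 0 R \<subseteq> (\<Union>s\<in>S. ball s d)"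
    by (rule compactE_image[OF compact_cball, of "-K" "\<lambda>s. ball s d", rotated]) auto
  define c where "c x s = max 0 (d - dist x s)" for x s :: complex
  have c: "0 \<le> c x s" "0 < c x s \<longleftrightarrow> dist x s < d" for x s
    by (auto simp: c_def)
  define F where "F x = (\<Sum>s\<in>S. of_real (c x s) * cis (2 * pi * z s))" for x
  have centre: "\<exists>s\<in>S. 0 < c x s" if "x \<in> cball 0 R" for x
  proof -
    obtain s where "s \<in> S" "x \<in> ball s d" using S(3) \<open>x \<in> cball 0 R\<close> by blast
    then show ?thesis using c(2)[of x s] by (auto simp: dist_commute)
  qed
  have "continuous_on (cball 0 R) F"
    unfolding F_def c_def by (intro continuous_intros)
  moreover have "F x \<noteq> 0" if x: "x \<in> cball 0 R" for x
  proof -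
    have "diameter (ball x d) < e"
      using d by simp
    moreover have "ball x d \<subseteq> cball 0 (R + 1)"
    proof
      fix y assume "y \<in> ball x d"
      then show "y \<in> cball 0 (R + 1)" using x d(2) dist_triangle[of 0 y x] by auto
    qed
    ultimately obtain B where B: "B \<in> C" "ball x d \<subseteq> B" using e(2) by blast
    obtain s0 where "s0 \<in> S" "0 < c x s0" using centre[OF x] by blast
    then show ?thesis
      unfolding F_def
    proof (intro positive_combination_nonzero[OF S(2) c(1)])
      fix s t assume "s \<in> S" "t \<in> S" "0 < c x s" "0 < c x t"
      then have "s \<in> B - K" "t \<in> B - K" using B(2) S(1) c(2) by auto
      then show "circ (z s - z t) < 1/3" using B(1) by (auto simp: C_def good_def)
    qed
  qed
  moreover have "F x \<bullet> x < 0" if x: "norm x = R" for x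
  proof -
    define \<beta> where "\<beta> = Arg (- x)"
    have x_polar: "x = - of_real R * cis \<beta>"
      unfolding \<beta>_def using x \<open>0 < R\<close> by (subst cis_Arg) (auto simp: sgn_div_norm scaleR_conv_of_real)
    \<comment> \<open>\<open>\<beta>\<close> is the inward direction at \<open>x\<close>, and all chosen directions nearby are within a quarter turn
      of it.\<close>
    have polar_dot: "cis (2 * pi * z s) \<bullet> x = - R * cos (2 * pi * (z s - \<beta> / (2 * pi)))" for s
    proof -
      have "2 * pi * (z s - \<beta> / (2 * pi)) = 2 * pi * z s - \<beta>" by (simp add: field_simps)
      then show ?thesis unfolding x_polar by (simp add: inner_complex_def cos_diff algebra_simps)
    qed
    have pos: "0 < cos (2 * pi * (z s - \<beta> / (2 * pi)))" if "s \<in> S" "0 < c x s" for s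
      using far[OF x, of s] that S(1) c(2) d(2) unfolding \<beta>_def
      by (intro cos_pos_if_circ_less) auto
    obtain s0 where s0: "s0 \<in> S" "0 < c x s0" using centre[of x] x by auto
    have "F x \<bullet> x = (\<Sum>s\<in>S. - (R * (c x s * cos (2 * pi * (z s - \<beta> / (2 * pi))))))"
      unfolding F_def inner_sum_left
    proof (rule sum.cong[OF refl])
      fix s
      have "(of_real (c x s) * cis (2 * pi * z s)) \<bullet> x = c x s * (cis (2 * pi * z s) \<bullet> x)"
        by (simp add: inner_complex_def algebra_simps)
      then show "(of_real (c x s) * cis (2 * pi * z s)) \<bullet> x
          = - (R * (c x s * cos (2 * pi * (z s - \<beta> / (2 * pi)))))" by (simp add: polar_dot)
    qed
    also have "\<dots> = - R * (\<Sum>s\<in>S. c x s * cos (2 * pi * (z s - \<beta> / (2 * pi))))"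
      by (simp add: sum_negf sum_distrib_left)
    also have "\<dots> < 0"
    proof -
      have "0 < (\<Sum>s\<in>S. c x s * cos (2 * pi * (z s - \<beta> / (2 * pi))))"
      proof (rule sum_pos2[OF S(2) s0(1)])
        show "0 < c x s0 * cos (2 * pi * (z s0 - \<beta> / (2 * pi)))" using pos[OF s0] s0 by simp
        show "0 \<le> c x s * cos (2 * pi * (z s - \<beta> / (2 * pi)))" if "s \<in> S" for s
          using pos[OF that] c(1)[of x s] by (cases "c x s = 0") (auto intro!: mult_nonneg_nonneg less_imp_le)
      qed
      then show ?thesis using \<open>0 < R\<close> by simp
    qed
    finally show ?thesis .
  qed
  ultimately show False using inward_field_has_zero[OF \<open>0 < R\<close>, of F] by metis
qed

text \<open>
  By invariance of dimension the inverse of the arc cannot embed an open subset of the plane into the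
  line.  Arcs may have positive area, so a measure argument would not do.
\<close>
lemma interior_arc_image_empty:
  fixes g :: "real \<Rightarrow> complex"
  assumes "arc g"
  shows "interior (path_image g) = {}"
proof (rule ccontr)
  assume ne: "interior (path_image g) \<noteq> {}"
  have "continuous_on {0..1} g" "inj_on g {0..1}" using assms by (simp_all add: arc_def path_def)
  then obtain h where h: "homeomorphism {0..1} (path_image g) g h"
    using homeomorphism_compact[of "{0..1}" g "path_image g"] unfolding path_image_def
    by (metis compact_Icc)
  have U: "interior (path_image g) \<subseteq> path_image g" by (rule interior_subset)
  have 1: "continuous_on (interior (path_image g)) h"
    by (rule continuous_on_subset[OF homeomorphism_cont2[OF h] U])
  have "inj_on h (path_image g)" by (rule inj_on_inverseI[of _ g]) (rule homeomorphism_apply2[OF h])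
  then have 2: "inj_on h (interior (path_image g))"
    by (rule inj_on_subset) (rule U)
  have "DIM(complex) \<le> DIM(real)"
    by (rule invariance_of_dimension[OF 1 open_interior 2 ne])
  then show False by simp
qed

lemma interior_finite_Union_empty:
  fixes \<A> :: "'a::topological_space set set"
  assumes "finite \<A>" "\<And>A. A \<in> \<A> \<Longrightarrow> closed A" "\<And>A. A \<in> \<A> \<Longrightarrow> interior A = {}"
  shows "interior (\<Union>\<A>) = {}"
  using assms
proof (induction rule: finite_induct)
  case (insert A \<A>)
  have "interior (A \<union> \<Union>\<A>) = interior A"
    by (rule interior_closed_Un_empty_interior) (use insert in auto)
  then show ?case using insert by simp
qed simp

section \<open>Angles and winding numbers of paths that need not be closed\<close>

lemma Arg_divide_int:
  assumes "u \<noteq> 0" "w \<noteq> 0"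
  shows "Arg u / (2 * pi) - Arg w / (2 * pi) - Arg (u / w) / (2 * pi) \<in> \<int>"
proof -
  have "cis (2 * pi * (Arg (u / w) / (2 * pi))) = sgn (u / w)" using assms by (simp add: cis_Arg)
  also have "\<dots> = cis (Arg u) / cis (Arg w)"
    using assms by (simp add: cis_Arg sgn_div_norm norm_divide scaleR_conv_of_real field_simps)
  also have "\<dots> = cis (2 * pi * (Arg u / (2 * pi) - Arg w / (2 * pi)))"
    by (simp add: cis_divide right_diff_distrib)
  finally show ?thesis using cis_eq_iff_diff_int by metis
qed

lemma circ_Arg_diff:
  assumes "u \<noteq> 0" "w \<noteq> 0"
  shows "circ (Arg u / (2 * pi) - Arg w / (2 * pi)) \<le> \<bar>Arg (u / w)\<bar> / (2 * pi)"
proof -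
  have "circ (Arg u / (2 * pi) - Arg w / (2 * pi))
      = circ (Arg (u / w) / (2 * pi) + (Arg u / (2 * pi) - Arg w / (2 * pi) - Arg (u / w) / (2 * pi)))"
    by simp
  also have "\<dots> = circ (Arg (u / w) / (2 * pi))"
    by (rule circ_add_int[OF Arg_divide_int[OF assms]])
  also have "\<dots> \<le> \<bar>Arg (u / w) / (2 * pi)\<bar>" by (rule circ_le_abs)
  finally show ?thesis by (simp add: abs_divide)
qed

lemma winding_number_Arg_int:
  assumes "path p" "r \<notin> path_image p"
  shows "Arg ((pathfinish p - r) / (pathstart p - r)) / (2 * pi) - Re (winding_number p r) \<in> \<int>"
proof -
  define w where "w = (pathfinish p - r) / (pathstart p - r)"
  have ne: "pathstart p - r \<noteq> 0" "pathfinish p - r \<noteq> 0"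
    using assms(2) pathstart_in_path_image pathfinish_in_path_image by fastforce+
  then have "w = exp (2 * pi * \<i> * winding_number p r)"
    using winding_number_exp_2pi[OF assms] by (simp add: w_def field_simps)
  then have "sgn w = cis (2 * pi * Re (winding_number p r))"
    by (simp add: sgn_div_norm scaleR_conv_of_real exp_eq_polar norm_mult)
  moreover have "w \<noteq> 0" using ne by (simp add: w_def)
  ultimately have "cis (2 * pi * (Arg w / (2 * pi))) = cis (2 * pi * Re (winding_number p r))"
    by (simp add: cis_Arg)
  then show ?thesis unfolding w_def by (rule cis_eq_iff_diff_int)
qed

text \<open>
  Weights for averaging over the vertices: essentially uniform, but the weight of \<open>v\<close> is switched off
  near the point \<open>q v\<close>.  This is needed because an edge may spiral into its end point \<open>q v\<close>, so that
  its turn, as seen from points near \<open>q v\<close>, can be unbounded.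
\<close>
lemma vanishing_weights:
  fixes q :: "'v::finite \<Rightarrow> complex"
  assumes "inj q" "2 \<le> CARD('v)"
  obtains share :: "'v \<Rightarrow> complex \<Rightarrow> real"
  where "\<And>v r. 0 \<le> share v r" "\<And>v r. share v r \<le> 1 / real (CARD('v) - 1)" "\<And>r. (\<Sum>v\<in>UNIV. share v r) = 1"
    "\<And>v x. isCont (share v) x" "\<And>v. eventually (\<lambda>r. share v r = 0) (nhds (q v))"
proof -
  define \<delta> where "\<delta> = Min (insert 1 {dist (q u) (q v) | u v. u \<noteq> v})"
  have fin: "finite {dist (q u) (q v) | u v. u \<noteq> v}"
    by (rule finite_subset[of _ "(\<lambda>(u, v). dist (q u) (q v)) ` UNIV"]) auto
  have "0 < \<delta>" unfolding \<delta>_def using fin \<open>inj q\<close> by (subst Min_gr_iff) (auto dest: injD)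
  have \<delta>: "\<delta> \<le> dist (q u) (q v)" if "u \<noteq> v" for u v
    unfolding \<delta>_def using fin that by (intro Min_le) auto
  define bump where "bump v r = min 1 (max 0 (4 * dist r (q v) / \<delta> - 1))" for v r
  have bump: "0 \<le> bump v r" "bump v r \<le> 1" for v r by (auto simp: bump_def)
  have bump1: "bump v r = 1" if "\<delta> / 2 \<le> dist r (q v)" for v r
    using that \<open>0 < \<delta>\<close> by (auto simp: bump_def field_simps)
  define total where "total r = (\<Sum>v\<in>UNIV. bump v r)" for r
  \<comment> \<open>No point is close to two vertices, so at most one bump is below \<open>1\<close>.\<close>
  have total: "real (CARD('v) - 1) \<le> total r" for r
  proof -
    obtain w where w: "\<And>v. v \<noteq> w \<Longrightarrow> bump v r = 1"
    proof (cases "\<exists>w. dist r (q w) < \<delta> / 2")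
      case True
      then obtain w where w: "dist r (q w) < \<delta> / 2" by blast
      show ?thesis
      proof (rule that, rule bump1, rule ccontr)
        fix v assume "v \<noteq> w" "\<not> \<delta> / 2 \<le> dist r (q v)"
        then have "dist (q v) (q w) < \<delta>"
          using w dist_triangle3[of "q v" "q w" r] by linarith
        then show False using \<delta>[OF \<open>v \<noteq> w\<close>] by simp
      qed
    next
      case False
      show ?thesis by (rule that[of undefined], rule bump1) (use False in \<open>auto simp: not_less\<close>)
    qed
    have "real (CARD('v) - 1) = (\<Sum>v\<in>-{w}. bump v r)" using w by (simp add: card_Diff_singleton Compl_eq_Diff_UNIV)
    also have "\<dots> \<le> total r" unfolding total_def by (rule sum_mono2) (use bump in auto)
    finally show ?thesis .
  qed
  have n1: "0 < real (CARD('v) - 1)" using assms(2) by simp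
  have total_pos: "0 < total r" for r using total[of r] n1 by linarith
  show ?thesis
  proof (rule that[of "\<lambda>v r. bump v r / total r"])
    show "0 \<le> bump v r / total r" for v r using bump total_pos[of r] by simp
    show "bump v r / total r \<le> 1 / real (CARD('v) - 1)" for v r
      using frac_le[OF zero_le_one bump(2)[of v r] n1 total[of r]] by simp
    show "(\<Sum>v\<in>UNIV. bump v r / total r) = 1" for r
      using total_pos[of r] by (simp add: total_def flip: sum_divide_distrib)
    show "isCont (\<lambda>r. bump v r / total r) x" for v x
      unfolding bump_def total_def
      by (intro continuous_intros) (use total_pos[of x] \<open>0 < \<delta>\<close> in \<open>auto simp: bump_def total_def\<close>)
    show "\<forall>\<^sub>F r in nhds (q v). bump v r / total r = 0" for v
      unfolding eventually_nhds_metric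
      by (intro exI[of _ "\<delta> / 4"]) (use \<open>0 < \<delta>\<close> in \<open>auto simp: bump_def field_simps\<close>)
  qed
qed

section \<open>Turns along the edges of a drawing of the complete graph\<close>

text \<open>
  The topological content of the hypotheses on \<open>f\<close>: edges are arcs, two edges with a common vertex
  meet only there, and the boundary of a triangle does not wind around a point outside its image.
  Edges without a common vertex may cross arbitrarily often.
\<close>
locale complete_drawing =
  fixes q :: "'v::finite \<Rightarrow> complex"
    and g :: "'v \<Rightarrow> 'v \<Rightarrow> real \<Rightarrow> complex"
    and face :: "'v set \<Rightarrow> complex set"
  assumes arc_g: "a \<noteq> b \<Longrightarrow> arc (g a b)"
    and g_start: "a \<noteq> b \<Longrightarrow> pathstart (g a b) = q a"
    and g_rev: "a \<noteq> b \<Longrightarrow> g b a = reversepath (g a b)"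
    and g_meet: "\<lbrakk>a \<noteq> b; b \<noteq> c; a \<noteq> c\<rbrakk> \<Longrightarrow> path_image (g a b) \<inter> path_image (g b c) \<subseteq> {q b}"
    and face_loop: "\<lbrakk>a \<noteq> b; b \<noteq> c; a \<noteq> c; r \<notin> face {a, b, c}\<rbrakk>
      \<Longrightarrow> winding_number (g a b +++ g b c +++ g c a) r = 0"
    and card_vertices: "3 \<le> CARD('v)"
begin

lemma g_finish: "a \<noteq> b \<Longrightarrow> pathfinish (g a b) = q b"
  using g_start[of b a] g_rev[of a b] by simp

lemma path_g: "a \<noteq> b \<Longrightarrow> path (g a b)"
  by (simp add: arc_g arc_imp_path)

lemma path_image_g_commute: "a \<noteq> b \<Longrightarrow> path_image (g a b) = path_image (g b a)"
  using g_rev[of a b] by simp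

lemma inj_q: "inj q"
proof (rule injI, rule ccontr)
  fix a b assume "q a = q b" "a \<noteq> b"
  then show False using arc_distinct_ends[OF arc_g[of a b]] g_start[of a b] g_finish[of a b] by simp
qed

definition skeleton :: "complex set" where
  "skeleton = \<Union>{path_image (g a b) | a b. a \<noteq> b}"

lemma path_image_subset_skeleton: "a \<noteq> b \<Longrightarrow> path_image (g a b) \<subseteq> skeleton"
  by (auto simp: skeleton_def)

lemma notin_skeleton: "r \<notin> skeleton \<Longrightarrow> a \<noteq> b \<Longrightarrow> r \<notin> path_image (g a b)"
  by (auto simp: skeleton_def)

lemma third_vertex: obtains c :: 'v where "c \<noteq> a" "c \<noteq> b"
proof -
  have "card {a, b} < CARD('v)" using card_vertices by (auto simp: card_insert_if)
  then have "{a, b} \<noteq> UNIV" by auto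
  then show ?thesis using that by blast
qed

lemma q_in_skeleton: "q a \<in> skeleton"
proof -
  obtain b where "b \<noteq> a" by (rule third_vertex)
  then have "q a \<in> path_image (g a b)" using g_start[of a b] pathstart_in_path_image[of "g a b"] by auto
  then show ?thesis using path_image_subset_skeleton[of a b] \<open>b \<noteq> a\<close> by auto
qed

lemma finite_edge_images: "finite {path_image (g a b) | a b. a \<noteq> b}"
  by (rule finite_subset[of _ "(\<lambda>(a, b). path_image (g a b)) ` UNIV"]) auto

lemma interior_skeleton: "interior skeleton = {}"
  unfolding skeleton_def
  by (rule interior_finite_Union_empty[OF finite_edge_images])
    (auto simp: arc_g path_g interior_arc_image_empty closed_path_image)

lemma bounded_skeleton: "bounded skeleton"
  unfolding skeleton_def
  by (rule bounded_Union[OF finite_edge_images]) (auto simp: path_g bounded_path_image)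

text \<open>
  The real part of the winding number of an open path is the number of full turns that it makes as
  seen from \<open>r\<close>.  The value \<open>0\<close> for \<open>a = b\<close> makes the cocycle identities hold for degenerate triangles.
\<close>
definition turn :: "'v \<Rightarrow> 'v \<Rightarrow> complex \<Rightarrow> real" where
  "turn a b r = (if a = b then 0 else Re (winding_number (g a b) r))"

definition winding :: "'v \<Rightarrow> 'v \<Rightarrow> 'v \<Rightarrow> complex \<Rightarrow> real" where
  "winding a b c r = turn a b r + turn b c r + turn c a r"

lemma turn_reverse: "r \<notin> skeleton \<Longrightarrow> turn b a r = - turn a b r"
  by (auto simp: turn_def g_rev[of a b] winding_number_reversepath path_g notin_skeleton)

lemma winding_degenerate: "r \<notin> skeleton \<Longrightarrow> winding a b a r = 0" "r \<notin> skeleton \<Longrightarrow> winding a b b r = 0"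
  using turn_reverse[of r a b] by (auto simp: winding_def turn_def)

lemma isCont_turn: "a = b \<or> x \<notin> path_image (g a b) \<Longrightarrow> isCont (turn a b) x"
proof (cases "a = b")
  case False
  assume "a = b \<or> x \<notin> path_image (g a b)"
  then have "isCont (\<lambda>r. Re (winding_number (g a b) r)) x"
    using False by (intro isCont_Re continuous_at_winding_number) (auto simp: path_g)
  then show ?thesis using False by (simp add: turn_def[abs_def])
qed (simp add: turn_def[abs_def])

lemma simple_loop:
  assumes "a \<noteq> b" "b \<noteq> c" "a \<noteq> c"
  shows "simple_path (g a b +++ g b c +++ g c a)"
proof -
  have bca: "path_image (g b c) \<inter> path_image (g c a) \<subseteq> {q c}"
    and abc: "path_image (g a b) \<inter> path_image (g b c) \<subseteq> {q b}"
    and cab: "path_image (g c a) \<inter> path_image (g a b) \<subseteq> {q a}"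
    using assms g_meet[of b c a] g_meet[of a b c] g_meet[of c a b] by blast+
  have "arc (g b c +++ g c a)"
    by (rule arc_join) (use assms bca in \<open>simp_all add: arc_g g_start g_finish\<close>)
  then show ?thesis
    by (intro simple_path_join_loop)
      (use assms abc cab in \<open>auto simp: arc_g g_start g_finish path_image_join\<close>)
qed

lemma winding_eq_winding_number:
  assumes "a \<noteq> b" "b \<noteq> c" "a \<noteq> c" "r \<notin> skeleton"
  shows "winding a b c r = Re (winding_number (g a b +++ g b c +++ g c a) r)"
  using assms
  by (simp add: winding_def turn_def winding_number_join path_g notin_skeleton g_start g_finish path_image_join)

text \<open>
  The winding number of a simple closed curve has the same sign at all points that it encloses, so it
  cannot change from \<open>1\<close> to \<open>-1\<close>.
\<close>
lemma winding_oscillation: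
  assumes "a \<noteq> b" "b \<noteq> c" "a \<noteq> c" "r \<notin> skeleton" "r' \<notin> skeleton"
  shows "\<bar>winding a b c r\<bar> \<le> 1" "\<bar>winding a b c r - winding a b c r'\<bar> \<le> 1"
proof -
  let ?p = "g a b +++ g b c +++ g c a"
  have loop: "pathfinish ?p = pathstart ?p" using assms by (simp add: g_start g_finish)
  have off: "s \<in> inside (path_image ?p) \<or> s \<in> outside (path_image ?p)" if "s \<notin> skeleton" for s
  proof -
    have "s \<notin> path_image ?p" using assms that by (simp add: path_image_join path_g g_start g_finish notin_skeleton)
    then show ?thesis using inside_Un_outside[of "path_image ?p"] by blast
  qed
  have out: "winding_number ?p s = 0" if "s \<in> outside (path_image ?p)" for s
    by (rule winding_number_zero_in_outside[OF simple_path_imp_path[OF simple_loop] loop that])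
      (use assms in auto)
  consider "\<And>s. s \<in> inside (path_image ?p) \<Longrightarrow> winding_number ?p s = 1"
    | "\<And>s. s \<in> inside (path_image ?p) \<Longrightarrow> winding_number ?p s = -1"
    using simple_closed_path_winding_number_inside[OF simple_loop[OF assms(1-3)]] by blast
  then show "\<bar>winding a b c r\<bar> \<le> 1" "\<bar>winding a b c r - winding a b c r'\<bar> \<le> 1"
    unfolding winding_eq_winding_number[OF assms(1-3) assms(4)] winding_eq_winding_number[OF assms(1-3) assms(5)]
    using off[OF assms(4)] off[OF assms(5)] out[of r] out[of r'] by (cases; fastforce)+
qed

lemma winding_le_face:
  assumes "a \<noteq> b" "b \<noteq> c" "a \<noteq> c" "r \<notin> skeleton"
  shows "\<bar>winding a b c r\<bar> \<le> (if r \<in> face {a, b, c} then 1 else 0)"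
  using winding_oscillation(1)[of a b c r] face_loop[of a b c r] winding_eq_winding_number[of a b c r] assms by auto

text \<open>The turn along an edge measures the change of the argument, up to full turns.\<close>
lemma Arg_turn_int:
  assumes "a \<noteq> b" "r \<notin> skeleton"
  shows "Arg (q a - r) / (2 * pi) - Arg (q b - r) / (2 * pi) + turn a b r \<in> \<int>"
proof -
  have ne: "q a - r \<noteq> 0" "q b - r \<noteq> 0" using q_in_skeleton assms(2) by auto
  have "Arg ((q b - r) / (q a - r)) / (2 * pi) - turn a b r \<in> \<int>"
    using winding_number_Arg_int[of "g a b" r] assms
    by (simp add: path_g notin_skeleton g_start g_finish turn_def)
  from Ints_add[OF this Arg_divide_int[OF ne(2,1)]]
  have "Arg (q b - r) / (2 * pi) - Arg (q a - r) / (2 * pi) - turn a b r \<in> \<int>" by simp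
  from Ints_minus[OF this] show ?thesis by (simp add: algebra_simps)
qed

end

section \<open>The mean direction in which a point sees the vertices\<close>

locale weighted_drawing = complete_drawing q g face
  for q :: "'v::finite \<Rightarrow> complex" and g :: "'v \<Rightarrow> 'v \<Rightarrow> real \<Rightarrow> complex"
    and face :: "'v set \<Rightarrow> complex set" +
  fixes share :: "'v \<Rightarrow> complex \<Rightarrow> real"
  assumes share_nonneg: "0 \<le> share v r"
    and share_le: "share v r \<le> 1 / real (CARD('v) - 1)"
    and share_sum: "(\<Sum>v\<in>UNIV. share v r) = 1"
    and isCont_share: "isCont (share v) x"
    and share_vanish: "eventually (\<lambda>r. share v r = 0) (nhds (q v))"
begin

text \<open>
  The mean over \<open>v\<close> of the direction of \<open>q v\<close> as seen from \<open>r\<close>, in full turns, where the direction of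
  \<open>q v\<close> is lifted to the line by continuation along the edge from \<open>b\<close> to \<open>v\<close>.  Only its class modulo
  \<open>1\<close> matters.
\<close>
definition direction :: "'v \<Rightarrow> complex \<Rightarrow> real" where
  "direction b r = Arg (q b - r) / (2 * pi) + (\<Sum>v\<in>UNIV. share v r * turn b v r)"

text \<open>
  Going from \<open>b\<close> to \<open>v\<close> directly or through \<open>a\<close> differs by the winding number of the triangle \<open>abv\<close>.
\<close>
lemma direction_diff_int:
  assumes "r \<notin> skeleton"
  shows "direction a r - direction b r + (\<Sum>v\<in>UNIV. share v r * winding a b v r) \<in> \<int>"
proof (cases "a = b")
  case True
  have "winding b b v r = 0" for v using turn_reverse[OF assms, of b v] by (simp add: winding_def turn_def[of b b])
  then show ?thesis using True by simp
next
  case False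
  have "(\<Sum>v\<in>UNIV. share v r * winding a b v r)
      = (\<Sum>v\<in>UNIV. share v r * turn a b r + (share v r * turn b v r - share v r * turn a v r))"
    by (intro sum.cong refl) (simp add: winding_def turn_reverse[OF assms, of a] algebra_simps)
  also have "\<dots> = turn a b r + ((\<Sum>v\<in>UNIV. share v r * turn b v r) - (\<Sum>v\<in>UNIV. share v r * turn a v r))"
    by (simp add: sum.distrib sum_subtractf share_sum flip: sum_distrib_right)
  finally have "direction a r - direction b r + (\<Sum>v\<in>UNIV. share v r * winding a b v r)
      = Arg (q a - r) / (2 * pi) - Arg (q b - r) / (2 * pi) + turn a b r"
    by (simp add: direction_def)
  then show ?thesis using Arg_turn_int[OF False assms] by simp
qed

lemma circ_direction_diff_le:
  assumes "r \<notin> skeleton" "a \<noteq> b"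
  shows "circ (direction a r - direction b r) \<le> card {v. v \<noteq> a \<and> v \<noteq> b \<and> r \<in> face {a, b, v}} / real (CARD('v) - 1)"
proof -
  define s where "s = (\<Sum>v\<in>UNIV. share v r * winding a b v r)"
  define N where "N = {v. v \<noteq> a \<and> v \<noteq> b \<and> r \<in> face {a, b, v}}"
  have "circ (direction a r - direction b r) = circ (- s + (direction a r - direction b r + s))" by simp
  also have "\<dots> = circ (- s)"
    by (rule circ_add_int) (use direction_diff_int[OF assms(1)] in \<open>simp add: s_def\<close>)
  also have "\<dots> \<le> \<bar>- s\<bar>" by (rule circ_le_abs)
  also have "\<dots> \<le> (\<Sum>v\<in>UNIV. \<bar>share v r * winding a b v r\<bar>)" by (simp add: s_def)
  also have "\<dots> \<le> (\<Sum>v\<in>UNIV. if v \<in> N then 1 / real (CARD('v) - 1) else 0)"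
  proof (rule sum_mono)
    fix v
    have "\<bar>winding a b v r\<bar> \<le> (if v \<in> N then 1 else 0)"
    proof (cases "v = a \<or> v = b")
      case True
      then have "winding a b v r = 0" using winding_degenerate[OF assms(1)] by blast
      then show ?thesis by simp
    next
      case False
      then show ?thesis using winding_le_face[of a b v r] assms by (auto simp: N_def)
    qed
    then have "share v r * \<bar>winding a b v r\<bar> \<le> 1 / real (CARD('v) - 1) * (if v \<in> N then 1 else 0)"
      by (intro mult_mono share_le) (auto simp: share_nonneg)
    then show "\<bar>share v r * winding a b v r\<bar> \<le> (if v \<in> N then 1 / real (CARD('v) - 1) else 0)"
      by (auto simp: abs_mult share_nonneg split: if_splits)
  qed
  also have "\<dots> = card N / real (CARD('v) - 1)" by (simp add: sum.If_cases)
  finally show ?thesis by (simp add: N_def)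
qed

lemma eventually_off_skeleton: "eventually P (inf (nhds x) (principal (- skeleton))) \<longleftrightarrow>
    (\<exists>d>0. \<forall>r\<in>ball x d - skeleton. P r)"
  unfolding eventually_inf_principal eventually_nhds_metric by (auto simp: dist_commute)

lemma isCont_imp_tendsto_off_skeleton:
  fixes h :: "complex \<Rightarrow> real"
  assumes "isCont h x"
  shows "(h \<longlongrightarrow> h x) (inf (nhds x) (principal (- skeleton)))"
  using assms by (intro tendsto_mono[OF inf_le1]) (simp add: continuous_at tendsto_at_iff_tendsto_nhds)

text \<open>
  If the edge \<open>bv\<close> passes through \<open>x\<close>, its turn may jump there.  Subtracting the winding number of
  a triangle \<open>bvc\<close> leaves the turns along \<open>vc\<close> and \<open>cb\<close>, and these edges avoid \<open>x\<close> since they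
  meet \<open>bv\<close> only at its ends.  So the summand of \<open>v\<close> is an integer multiple of its weight at \<open>x\<close>, up
  to a function with a limit.  If \<open>x\<close> is the end point \<open>q v\<close>, the weight vanishes near \<open>x\<close>.
\<close>
lemma direction_summand_local:
  assumes x: "x \<noteq> q b" and c: "x \<in> path_image (g b v) \<Longrightarrow> b \<noteq> v \<Longrightarrow> c \<noteq> b \<and> c \<noteq> v"
    and m: "m = (if v \<noteq> b \<and> x \<in> path_image (g b v) then share v x else 0)"
  shows "\<exists>l. ((\<lambda>r. share v r * turn b v r - m * winding b v c r) \<longlongrightarrow> l) (inf (nhds x) (principal (- skeleton)))"
    (is "\<exists>l. (_ \<longlongrightarrow> l) ?F")
proof -
  note tendsto_F = isCont_imp_tendsto_off_skeleton
  show ?thesis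
  proof (cases "v \<noteq> b \<and> x \<in> path_image (g b v)")
    case False
    then have "isCont (turn b v) x" by (intro isCont_turn) auto
    then have "isCont (\<lambda>r. share v r * turn b v r) x" using isCont_share by (intro continuous_intros)
    from tendsto_F[OF this] show ?thesis using False by (auto simp: m)
  next
    case True
    then have c: "c \<noteq> b" "c \<noteq> v" using c by auto
    show ?thesis
    proof (cases "x = q v")
      case True
      have "eventually (\<lambda>r. share v r = 0) (nhds x)" using share_vanish True by simp
      then have *: "eventually (\<lambda>r. share v r = 0) ?F" by (rule filter_leD[OF inf_le1])
      have "share v x = 0" using \<open>eventually (\<lambda>r. share v r = 0) (nhds x)\<close> by (rule eventually_nhds_x_imp_x)
      then have "m = 0" by (simp add: m)
      from * have "eventually (\<lambda>r. share v r * turn b v r - m * winding b v c r = 0) ?F"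
        by (rule eventually_mono) (simp add: \<open>m = 0\<close>)
      then show ?thesis by (intro exI[of _ 0] tendsto_eventually)
    next
      case False
      have "x \<notin> path_image (g v c)"
        using g_meet[of b v c] c True False by blast
      then have 1: "isCont (turn v c) x" by (intro isCont_turn) auto
      have "x \<notin> path_image (g c b)"
        using g_meet[of c b v] c True x by blast
      then have 2: "isCont (turn c b) x" by (intro isCont_turn) auto
      have eq: "share v r * turn b v r - m * winding b v c r
          = (share v r - share v x) * winding b v c r - share v r * (turn v c r + turn c b r)" for r
        using True by (simp add: m winding_def algebra_simps)
      have "((\<lambda>r. share v r - share v x) \<longlongrightarrow> 0) ?F"
        using tendsto_diff[OF tendsto_F[OF isCont_share[of x v]] tendsto_const[of "share v x"]] by simp
      then have null: "((\<lambda>r. \<bar>share v r - share v x\<bar>) \<longlongrightarrow> 0) ?F" by (rule tendsto_rabs_zero)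
      have "eventually (\<lambda>r. norm ((share v r - share v x) * winding b v c r) \<le> \<bar>share v r - share v x\<bar>) ?F"
        unfolding eventually_inf_principal
      proof (intro always_eventually allI impI)
        fix r assume "r \<in> - skeleton"
        then have "\<bar>winding b v c r\<bar> \<le> 1" using winding_oscillation(1)[of b v c r r] True c by auto
        then show "norm ((share v r - share v x) * winding b v c r) \<le> \<bar>share v r - share v x\<bar>"
          by (simp add: abs_mult mult_left_le)
      qed
      then have "((\<lambda>r. (share v r - share v x) * winding b v c r) \<longlongrightarrow> 0) ?F"
        using null by (rule Lim_null_comparison)
      moreover have "((\<lambda>r. share v r * (turn v c r + turn c b r)) \<longlongrightarrow> share v x * (turn v c x + turn c b x)) ?F"
      proof -
        have "isCont (\<lambda>r. share v r * (turn v c r + turn c b r)) x" by (intro continuous_intros isCont_share 1 2)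
        from tendsto_F[OF this] show ?thesis .
      qed
      ultimately show ?thesis unfolding eq by (intro exI) (rule tendsto_diff)
    qed
  qed
qed

text \<open>
  At most one edge at \<open>b\<close> passes through \<open>x\<close>, so at most one summand jumps, by at most its weight.
\<close>
lemma direction_local_oscillation:
  assumes x: "x \<noteq> q b" and "0 < \<epsilon>"
  shows "\<exists>d>0. \<forall>r\<in>ball x d - skeleton. \<forall>r'\<in>ball x d - skeleton. circ (direction b r - direction b r') \<le> 1 / real (CARD('v) - 1) + \<epsilon>"
proof -
  let ?F = "inf (nhds x) (principal (- skeleton))"
  define hit where "hit v \<longleftrightarrow> v \<noteq> b \<and> x \<in> path_image (g b v)" for v
  have uniq: "u = v" if "hit u" "hit v" for u v
    using that x g_meet[of u b v] path_image_g_commute[of u b] unfolding hit_def by blast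
  obtain v0 where v0: "\<And>v. hit v \<Longrightarrow> v = v0"
    using uniq by (cases "\<exists>v. hit v") blast+
  obtain c where c: "c \<noteq> b" "c \<noteq> v0" by (rule third_vertex)
  define m where "m v = (if hit v then share v x else 0)" for v
  have "\<exists>l. ((\<lambda>r. share v r * turn b v r - m v * winding b v c r) \<longlongrightarrow> l) ?F" for v
    using c v0[of v] by (intro direction_summand_local x) (auto simp: m_def hit_def)
  then obtain l where l: "\<And>v. ((\<lambda>r. share v r * turn b v r - m v * winding b v c r) \<longlongrightarrow> l v) ?F" by metis
  define S where "S r = (\<Sum>v\<in>UNIV. share v r * turn b v r - m v * winding b v c r)" for r
  have S: "(S \<longlongrightarrow> (\<Sum>v\<in>UNIV. l v)) ?F" unfolding S_def by (intro tendsto_sum l)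
  have "isCont (\<lambda>r. \<bar>Arg ((q b - r) / (q b - x))\<bar> / (2 * pi)) x"
    using x by (intro continuous_intros isCont_o2[OF _ continuous_at_Arg]) auto
  from isCont_imp_tendsto_off_skeleton[OF this] x
  have A: "((\<lambda>r. \<bar>Arg ((q b - r) / (q b - x))\<bar> / (2 * pi)) \<longlongrightarrow> 0) ?F" by simp
  have "eventually (\<lambda>r. \<bar>Arg ((q b - r) / (q b - x))\<bar> / (2 * pi) < \<epsilon> / 4 \<and> \<bar>S r - (\<Sum>v\<in>UNIV. l v)\<bar> < \<epsilon> / 4) ?F"
    using order_tendstoD(2)[OF A, of "\<epsilon> / 4"] tendstoD[OF S, of "\<epsilon> / 4"] \<open>0 < \<epsilon>\<close>
    by (intro eventually_conj) (simp_all add: dist_real_def)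
  then obtain d where "0 < d" and d: "\<And>r. r \<in> ball x d - skeleton \<Longrightarrow>
      \<bar>Arg ((q b - r) / (q b - x))\<bar> / (2 * pi) < \<epsilon> / 4 \<and> \<bar>S r - (\<Sum>v\<in>UNIV. l v)\<bar> < \<epsilon> / 4"
    unfolding eventually_off_skeleton by blast
  have sum_split: "(\<Sum>v\<in>UNIV. share v r * turn b v r) = S r + m v0 * winding b v0 c r" for r
  proof -
    have "(\<Sum>v\<in>UNIV. m v * winding b v c r) = (\<Sum>v\<in>{v0}. m v * winding b v c r)"
      by (rule sum.mono_neutral_right) (use v0 in \<open>auto simp: m_def\<close>)
    then show ?thesis by (simp add: S_def sum_subtractf)
  qed
  have jump: "\<bar>m v0 * winding b v0 c r - m v0 * winding b v0 c r'\<bar> \<le> 1 / real (CARD('v) - 1)" if "r \<notin> skeleton" "r' \<notin> skeleton" for r r'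
  proof (cases "hit v0")
    case True
    then have "\<bar>winding b v0 c r - winding b v0 c r'\<bar> \<le> 1" using c that by (intro winding_oscillation(2)) (auto simp: hit_def)
    then have "share v0 x * \<bar>winding b v0 c r - winding b v0 c r'\<bar> \<le> 1 / real (CARD('v) - 1) * 1"
      by (intro mult_mono share_le) auto
    then show ?thesis using True by (simp add: m_def abs_mult share_nonneg flip: right_diff_distrib)
  qed (simp add: m_def)
  show ?thesis
  proof (intro exI[of _ d] conjI ballI \<open>0 < d\<close>)
    fix r r' assume r: "r \<in> ball x d - skeleton" and r': "r' \<in> ball x d - skeleton"
    have ne: "q b - r \<noteq> 0" "q b - r' \<noteq> 0" "q b - x \<noteq> 0" using q_in_skeleton r r' x by auto
    let ?A = "\<lambda>r. Arg (q b - r) / (2 * pi)"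
    let ?B = "\<lambda>r. (\<Sum>v\<in>UNIV. share v r * turn b v r)"
    have "circ (direction b r - direction b r') = circ ((?A r - ?A r') + (?B r - ?B r'))"
      unfolding direction_def by (rule arg_cong[where f = circ]) simp
    also have "\<dots> \<le> circ (?A r - ?A r') + circ (?B r - ?B r')" by (rule circ_triangle)
    also have "circ (?A r - ?A r') \<le> circ (?A r - ?A x) + circ (?A x - ?A r')" by (rule circ_triangle_diff)
    also have "\<dots> \<le> \<epsilon> / 4 + \<epsilon> / 4"
      using circ_Arg_diff[OF ne(1,3)] circ_Arg_diff[OF ne(2,3)] d[OF r] d[OF r']
        circ_diff_commute[of "?A x" "?A r'"] by linarith
    also have "circ (?B r - ?B r') \<le> \<bar>?B r - ?B r'\<bar>" by (rule circ_le_abs)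
    also have "\<dots> \<le> 1 / real (CARD('v) - 1) + \<epsilon> / 2"
    proof -
      have combine: "\<bar>s + p - (s' + p')\<bar> \<le> k + \<epsilon> / 2"
        if "\<bar>s - t\<bar> < \<epsilon> / 4" "\<bar>s' - t\<bar> < \<epsilon> / 4" "\<bar>p - p'\<bar> \<le> k" for s s' t p p' k :: real
        using that by linarith
      have "r \<notin> skeleton" "r' \<notin> skeleton" using r r' by auto
      then show ?thesis
        unfolding sum_split by (rule combine[OF conjunct2[OF d[OF r]] conjunct2[OF d[OF r']] jump])
    qed
    finally show "circ (direction b r - direction b r') \<le> 1 / real (CARD('v) - 1) + \<epsilon>" by simp
  qed
qed

text \<open>
  From far away the whole drawing is seen under a small angle, so the turns along the edges are small
  and every mean direction is close to the direction of the origin.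
\<close>
lemma direction_far:
  obtains R where "0 < R"
    "\<And>x r b. norm x = R \<Longrightarrow> r \<notin> skeleton \<Longrightarrow> dist x r < 1 \<Longrightarrow> circ (direction b r - Arg (- x) / (2 * pi)) < 1/4"
proof -
  obtain M where M: "0 < M" "\<And>y. y \<in> skeleton \<Longrightarrow> norm y \<le> M" using bounded_skeleton unfolding bounded_pos by blast
  have "isCont Arg 1" by (rule continuous_at_Arg) auto
  then obtain \<epsilon> where "0 < \<epsilon>" and \<epsilon>: "\<And>w. dist w 1 < \<epsilon> \<Longrightarrow> dist (Arg w) (Arg 1) < pi / 8"
    unfolding continuous_at_eps_delta using pi_gt_zero by (metis divide_pos_pos zero_less_numeral)
  have Arg_small: "\<bar>Arg (u / w)\<bar> / (2 * pi) < 1/16" if "norm (u - w) < \<epsilon> * norm w" for u w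
  proof -
    have "w \<noteq> 0" using that by auto
    then have "dist (u / w) 1 = norm (u - w) / norm w"
      by (simp add: dist_norm diff_divide_distrib flip: norm_divide)
    then have "dist (u / w) 1 < \<epsilon>" using that \<open>w \<noteq> 0\<close> by (simp add: divide_less_eq)
    from \<epsilon>[OF this] show ?thesis by (simp add: dist_real_def divide_less_eq)
  qed
  define R where "R = M + 2 + (2 * M + 2) / \<epsilon>"
  have Me: "0 < (2 * M + 2) / \<epsilon>" using M(1) \<open>0 < \<epsilon>\<close> by simp
  then have "0 < R" using M(1) by (simp add: R_def)
  have turn_small: "\<bar>turn b v r\<bar> < 1/16" if r: "r \<notin> skeleton" "R - 1 < norm r" for b v r
  proof (cases "b = v")
    case False
    have out: "r \<notin> cball 0 M" using r(2) Me by (simp add: R_def)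
    have in_ball: "g b v t \<in> cball 0 M" if "t \<in> {0..1}" for t
    proof -
      have "g b v t \<in> path_image (g b v)" using that by (simp add: path_image_def)
      then show ?thesis using path_image_subset_skeleton[OF False] M(2) by auto
    qed
    have "q b \<in> cball 0 M" "q v \<in> cball 0 M" using M(2)[OF q_in_skeleton] by auto
    then have seg: "closed_segment (q b) (q v) \<subseteq> cball 0 M" by (intro closed_segment_subset convex_cball)
    \<comment> \<open>Inside a disc that does not contain \<open>r\<close> the edge can be straightened.\<close>
    have "winding_number (linepath (q b) (q v)) r = winding_number (g b v) r"
    proof (rule winding_number_paths_linear_eq)
      fix t :: real assume t: "t \<in> {0..1}"
      have "linepath (q b) (q v) t \<in> cball 0 M" using seg linepath_in_path[OF t] by blast
      then have "closed_segment (g b v t) (linepath (q b) (q v) t) \<subseteq> cball 0 M"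
        using in_ball[OF t] by (intro closed_segment_subset convex_cball)
      then show "r \<notin> closed_segment (g b v t) (linepath (q b) (q v) t)" using out by blast
    qed (use False in \<open>simp_all add: path_g g_start g_finish\<close>)
    then have "\<bar>turn b v r\<bar> < 1/2"
      using winding_number_lt_half_linepath[OF contra_subsetD[OF seg out]] False by (simp add: turn_def)
    moreover have "\<bar>Arg ((q v - r) / (q b - r))\<bar> / (2 * pi) < 1/16"
    proof (rule Arg_small)
      have "norm (q v - r - (q b - r)) \<le> 2 * M"
        using norm_triangle_ineq4[of "q v" "q b"] M(2)[OF q_in_skeleton[of v]] M(2)[OF q_in_skeleton[of b]] by simp
      also have "\<dots> < \<epsilon> * ((2 * M + 2) / \<epsilon>)" using \<open>0 < \<epsilon>\<close> by simp
      also have "\<dots> \<le> \<epsilon> * norm (q b - r)"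
      proof (rule mult_left_mono)
        show "(2 * M + 2) / \<epsilon> \<le> norm (q b - r)"
          using norm_triangle_ineq3[of r "q b"] M(2)[OF q_in_skeleton[of b]] r(2)
          by (simp add: R_def norm_minus_commute)
      qed (use \<open>0 < \<epsilon>\<close> in simp)
      finally show "norm (q v - r - (q b - r)) < \<epsilon> * norm (q b - r)" .
    qed
    moreover have "Arg ((q v - r) / (q b - r)) / (2 * pi) - turn b v r \<in> \<int>"
      using winding_number_Arg_int[of "g b v" r] False r(1)
      by (simp add: path_g notin_skeleton g_start g_finish turn_def)
    then obtain k where k: "Arg ((q v - r) / (q b - r)) / (2 * pi) - turn b v r = of_int k" by (auto elim: Ints_cases)
    ultimately have A: "\<bar>Arg ((q v - r) / (q b - r)) / (2 * pi)\<bar> < 1/16" and "\<bar>turn b v r\<bar> < 1/2"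
      by (simp_all add: abs_divide)
    then have "\<bar>real_of_int k\<bar> < 1" unfolding k[symmetric] by linarith
    then have "k = 0" by linarith
    then show ?thesis using k A by simp
  qed (simp add: turn_def)
  have "circ (direction b r - Arg (- x) / (2 * pi)) < 1/4"
    if x: "norm x = R" and r: "r \<notin> skeleton" and xr: "dist x r < 1" for x r b
  proof -
    let ?S = "\<Sum>v\<in>UNIV. share v r * turn b v r"
    have "R - 1 < norm r" using x xr norm_triangle_ineq2[of x r] by (simp add: dist_norm)
    note Ls = turn_small[OF r this]
    have "\<bar>?S\<bar> \<le> (\<Sum>v\<in>UNIV. \<bar>share v r * turn b v r\<bar>)" by simp
    also have "\<dots> \<le> (\<Sum>v\<in>UNIV. share v r * (1/16))"
      unfolding abs_mult abs_of_nonneg[OF share_nonneg]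
      by (intro sum_mono mult_left_mono less_imp_le[OF Ls] share_nonneg)
    also have "\<dots> = 1/16" by (simp add: share_sum flip: sum_divide_distrib)
    finally have S: "circ ?S \<le> 1/16" using circ_le_abs[of ?S] by linarith
    have "\<bar>Arg ((q b - r) / (- x))\<bar> / (2 * pi) < 1/16"
    proof (rule Arg_small)
      have "norm (q b - r - (- x)) = norm (q b + (x - r))" by (simp add: algebra_simps)
      also have "\<dots> \<le> M + 1"
        using norm_triangle_ineq[of "q b" "x - r"] M(2)[OF q_in_skeleton[of b]] xr by (simp add: dist_norm)
      also have "\<dots> < \<epsilon> * ((2 * M + 2) / \<epsilon>)" using \<open>0 < \<epsilon>\<close> M(1) by simp
      also have "\<dots> \<le> \<epsilon> * norm (- x)"
        using \<open>0 < \<epsilon>\<close> M(1) x by (intro mult_left_mono) (auto simp: R_def)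
      finally show "norm (q b - r - (- x)) < \<epsilon> * norm (- x)" .
    qed
    moreover have "q b - r \<noteq> 0" "- x \<noteq> 0" using q_in_skeleton r x \<open>0 < R\<close> by auto
    ultimately have "circ (Arg (q b - r) / (2 * pi) - Arg (- x) / (2 * pi)) < 1/16"
      using circ_Arg_diff[of "q b - r" "- x"] by linarith
    moreover have "circ (direction b r - Arg (- x) / (2 * pi))
        \<le> circ (Arg (q b - r) / (2 * pi) - Arg (- x) / (2 * pi)) + circ ?S"
      using circ_triangle[of "Arg (q b - r) / (2 * pi) - Arg (- x) / (2 * pi)" ?S]
      by (simp add: direction_def algebra_simps)
    ultimately show ?thesis using S by linarith
  qed
  with \<open>0 < R\<close> show ?thesis by (rule that)
qed

section \<open>A point in many triangles at every vertex\<close>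

text \<open>
  Every triangle at \<open>a\<close> that contains \<open>r\<close> is counted twice, once for each order of its two other
  vertices.
\<close>
definition covering_pairs :: "'v \<Rightarrow> complex \<Rightarrow> ('v \<times> 'v) set" where
  "covering_pairs a r = {(b, v). b \<noteq> a \<and> v \<noteq> a \<and> v \<noteq> b \<and> r \<in> face {a, b, v}}"

lemma sum_circ_direction_diff_le:
  assumes "r \<notin> skeleton"
  shows "(\<Sum>b\<in>B. circ (direction a r - direction b r)) \<le> card (covering_pairs a r) / real (CARD('v) - 1)"
proof -
  define N where "N b = {v. v \<noteq> a \<and> v \<noteq> b \<and> r \<in> face {a, b, v}}" for b
  have "(\<Sum>b\<in>B. circ (direction a r - direction b r)) \<le> (\<Sum>b\<in>UNIV. circ (direction a r - direction b r))"
    by (rule sum_mono2) auto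
  also have "\<dots> = (\<Sum>b\<in>-{a}. circ (direction a r - direction b r))"
    by (rule sum.mono_neutral_right) (auto simp: circ_def)
  also have "\<dots> \<le> (\<Sum>b\<in>-{a}. card (N b) / real (CARD('v) - 1))"
    unfolding N_def by (intro sum_mono circ_direction_diff_le assms) auto
  also have "\<dots> = card (SIGMA b:-{a}. N b) / real (CARD('v) - 1)"
    by (simp add: sum_divide_distrib)
  also have "(SIGMA b:-{a}. N b) = covering_pairs a r"
    by (auto simp: covering_pairs_def N_def)
  finally show ?thesis .
qed

text \<open>
  The term \<open>1 / (n - 1)\<close> accounts for a jump.  The other term is twice a bound on the mean distance of
  the chosen direction to the \<open>direction b\<close>, since each of two points contributes once.

  The directions chosen at two nearby points are compared through \<open>direction b\<close> for all \<open>b\<close>, and the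
  resulting bounds are averaged over \<open>b\<close>.  If \<open>x\<close> is the position \<open>q w\<close> of a vertex, then \<open>b = w\<close> has
  to be left out, because the argument of \<open>q w - r\<close> takes all values near \<open>x\<close>.
\<close>
lemma selection_close:
  assumes few: "\<And>r. r \<notin> skeleton \<Longrightarrow>
      1 / real (CARD('v) - 1) + 2 * real (card (covering_pairs (\<alpha> r) r)) / real (CARD('v) - 1)^2 \<le> c"
    and "c < 1/3"
  shows "\<exists>d>0. \<forall>r\<in>ball x d - skeleton. \<forall>r'\<in>ball x d - skeleton. circ (direction (\<alpha> r) r - direction (\<alpha> r') r') < 1/3"
proof -
  define n1 where "n1 = real (CARD('v) - 1)"
  have n1: "0 < n1" using card_vertices by (simp add: n1_def)
  define \<epsilon> where "\<epsilon> = (1/3 - c) / 2"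
  have "0 < \<epsilon>" using assms(2) by (simp add: \<epsilon>_def)
  obtain w where w: "\<And>b. b \<noteq> w \<Longrightarrow> x \<noteq> q b"
  proof (cases "\<exists>w. x = q w")
    case True
    then show ?thesis using that inj_q by (metis injD)
  next
    case False
    then show ?thesis using that[of undefined] by blast
  qed
  obtain D where D: "\<And>b. b \<noteq> w \<Longrightarrow> 0 < D b" "\<And>b r r'. b \<noteq> w \<Longrightarrow> r \<in> ball x (D b) - skeleton \<Longrightarrow>
      r' \<in> ball x (D b) - skeleton \<Longrightarrow> circ (direction b r - direction b r') \<le> 1 / n1 + \<epsilon>"
    using direction_local_oscillation[OF w \<open>0 < \<epsilon>\<close>] unfolding n1_def by metis
  define d where "d = Min (insert 1 (D ` (-{w})))"
  have "0 < d" unfolding d_def using D(1) by (subst Min_gr_iff) auto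
  have d_le: "d \<le> D b" if "b \<noteq> w" for b unfolding d_def using that by (intro Min_le) auto
  have "circ (direction (\<alpha> r) r - direction (\<alpha> r') r') < 1/3" if r: "r \<in> ball x d - skeleton" and r': "r' \<in> ball x d - skeleton" for r r'
  proof -
    let ?a = "\<alpha> r" and ?a' = "\<alpha> r'"
    have "n1 * circ (direction ?a r - direction ?a' r') = (\<Sum>b\<in>-{w}. circ (direction ?a r - direction ?a' r'))"
      by (simp add: n1_def Compl_eq_Diff_UNIV card_Diff_singleton)
    also have "\<dots> \<le> (\<Sum>b\<in>-{w}. circ (direction ?a r - direction b r) + (1 / n1 + \<epsilon>) + circ (direction ?a' r' - direction b r'))"
    proof (rule sum_mono)
      fix b assume "b \<in> -{w}"
      then have b: "b \<noteq> w" by simp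
      have "circ (direction b r - direction b r') \<le> 1 / n1 + \<epsilon>"
        using r r' d_le[OF b] by (intro D(2)[OF b]) auto
      moreover have "circ (direction ?a r - direction ?a' r') \<le> circ (direction ?a r - direction b r) + circ (direction b r - direction ?a' r')"
        by (rule circ_triangle_diff)
      moreover have "circ (direction b r - direction ?a' r') \<le> circ (direction b r - direction b r') + circ (direction b r' - direction ?a' r')"
        by (rule circ_triangle_diff)
      moreover have "circ (direction b r' - direction ?a' r') = circ (direction ?a' r' - direction b r')"
        by (rule circ_diff_commute)
      ultimately show "circ (direction ?a r - direction ?a' r')
          \<le> circ (direction ?a r - direction b r) + (1 / n1 + \<epsilon>) + circ (direction ?a' r' - direction b r')"
        by linarith
    qed
    also have "\<dots> = (\<Sum>b\<in>-{w}. circ (direction ?a r - direction b r)) + n1 * (1 / n1 + \<epsilon>)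
        + (\<Sum>b\<in>-{w}. circ (direction ?a' r' - direction b r'))"
      by (simp add: sum.distrib n1_def Compl_eq_Diff_UNIV card_Diff_singleton)
    also have "\<dots> \<le> card (covering_pairs ?a r) / n1 + n1 * (1 / n1 + \<epsilon>) + card (covering_pairs ?a' r') / n1"
      using r r' unfolding n1_def by (intro add_mono sum_circ_direction_diff_le order_refl) auto
    also have "\<dots> = n1 * ((1 / n1 + 2 * real (card (covering_pairs ?a r)) / n1^2) / 2
        + (1 / n1 + 2 * real (card (covering_pairs ?a' r')) / n1^2) / 2 + \<epsilon>)"
      using n1 by (simp add: field_simps power2_eq_square)
    also have "\<dots> \<le> n1 * (c / 2 + c / 2 + \<epsilon>)"
      using few[of r] few[of r'] r r' n1 unfolding n1_def[symmetric]
      by (intro mult_left_mono add_mono divide_right_mono) auto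
    finally have "circ (direction ?a r - direction ?a' r') \<le> c / 2 + c / 2 + \<epsilon>"
      using n1 by (simp only: mult_le_cancel_left_pos)
    also have "\<dots> < 1/3" using assms(2) by (simp add: \<epsilon>_def field_simps)
    finally show ?thesis .
  qed
  with \<open>0 < d\<close> show ?thesis by blast
qed

text \<open>
  Otherwise a vertex chosen at every point, with few triangles covering the point, would give a
  nearly continuous direction that points inwards far away.
\<close>
theorem deep_point:
  assumes "c < 1/3"
  obtains r where "\<And>a. c < 1 / real (CARD('v) - 1) + 2 * real (card (covering_pairs a r)) / real (CARD('v) - 1)^2"
proof (rule ccontr)
  assume "\<not> thesis"
  then have "\<exists>a. 1 / real (CARD('v) - 1) + 2 * real (card (covering_pairs a r)) / real (CARD('v) - 1)^2 \<le> c" for r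
    using that not_less by blast
  then obtain \<alpha> where \<alpha>: "\<And>r. 1 / real (CARD('v) - 1) + 2 * real (card (covering_pairs (\<alpha> r) r)) / real (CARD('v) - 1)^2 \<le> c"
    by metis
  obtain R where "0 < R" and R:
    "\<And>x r b. norm x = R \<Longrightarrow> r \<notin> skeleton \<Longrightarrow> dist x r < 1 \<Longrightarrow> circ (direction b r - Arg (- x) / (2 * pi)) < 1/4"
    using direction_far by blast
  show False
    by (rule no_circle_selection[OF interior_skeleton selection_close[OF \<alpha> assms] \<open>0 < R\<close> R])
qed

end

section \<open>The drawing given by the images of the edges\<close>

definition plane :: "real ^ 2 \<Rightarrow> complex" where
  "plane y = Complex (y $ 1) (y $ 2)"

lemma inj_plane: "inj plane"
  by (auto simp: inj_def plane_def vec_eq_iff forall_2)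

lemma continuous_on_plane: "continuous_on S plane"
  unfolding plane_def Complex_eq by (intro continuous_intros)

lemma surj_plane: "surj plane"
proof
  show "UNIV \<subseteq> range plane"
  proof
    fix z
    have "plane (vector [Re z, Im z]) = z" by (simp add: plane_def)
    then show "z \<in> range plane" by (metis rangeI)
  qed
qed simp

lemma cell_singleton: "cell {a} = {vert a}"
  by (simp add: cell_def)

lemma cell_pair: "cell {a, b} = closed_segment (vert a) (vert b)"
  by (simp add: cell_def segment_convex_hull)

lemma vert_eq_iff: "vert a = vert b \<longleftrightarrow> a = b"
  by (simp add: vert_def axis_eq_axis)

lemma cell_mono: "s \<subseteq> t \<Longrightarrow> cell s \<subseteq> cell t"
  by (auto simp: cell_def intro!: hull_mono)

lemma cells_meet:
  assumes "a \<noteq> b" "b \<noteq> c" "a \<noteq> c"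
  shows "cell {a, b} \<inter> cell {b, c} \<subseteq> {vert b}"
proof
  fix y assume y: "y \<in> cell {a, b} \<inter> cell {b, c}"
  then obtain u where u: "y = (1 - u) *\<^sub>R vert a + u *\<^sub>R vert b"
    by (auto simp: cell_pair in_segment)
  from y obtain w where w: "y = (1 - w) *\<^sub>R vert b + w *\<^sub>R vert c"
    by (auto simp: cell_pair in_segment)
  have "y $ c = 0" using assms by (simp add: u vert_def axis_def)
  moreover have "y $ c = w" using assms by (simp add: w vert_def axis_def)
  ultimately show "y \<in> {vert b}" using w by simp
qed

text \<open>
  The edge from \<open>a\<close> to \<open>b\<close> is parametrised by the homeomorphism that belongs to the cell \<open>{a, b}\<close>;
  the map \<open>f\<close> itself need not be injective on the cell.  That two edges with a common vertex meet
  only there is seen inside the image of the triangle which they span.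
\<close>
lemma simplicial_images_drawing:
  fixes f :: "real ^ 'v::finite \<Rightarrow> real ^ 2"
  assumes "simplicial_images f" and "3 \<le> CARD('v)"
  obtains g where "complete_drawing (\<lambda>v. plane (f (vert v))) g (\<lambda>t. plane ` f ` cell t)"
proof -
  have "\<forall>s\<in>E \<union> T. \<exists>h. (\<exists>k. homeomorphism (cell s) (f ` cell s) h k) \<and> (\<forall>s'\<subseteq>s. h ` cell s' = f ` cell s')"
    using assms(1) unfolding simplicial_images_def by simp
  from bchoice[OF this] obtain H where HH: "\<forall>s\<in>E \<union> T.
      (\<exists>k. homeomorphism (cell s) (f ` cell s) (H s) k) \<and> (\<forall>s'\<subseteq>s. H s ` cell s' = f ` cell s')"
    by (rule exE)
  then have H: "\<And>s. s \<in> E \<union> T \<Longrightarrow> \<exists>k. homeomorphism (cell s) (f ` cell s) (H s) k"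
    and Hf: "\<And>s s'. s \<in> E \<union> T \<Longrightarrow> s' \<subseteq> s \<Longrightarrow> H s ` cell s' = f ` cell s'"
    by simp_all
  have cont_H: "continuous_on (cell s) (H s)" and inj_H: "inj_on (H s) (cell s)" if s: "s \<in> E \<union> T" for s
  proof -
    obtain k where k: "homeomorphism (cell s) (f ` cell s) (H s) k" using H[OF s] by (rule exE)
    show "continuous_on (cell s) (H s)" by (rule homeomorphism_cont1[OF k])
    show "inj_on (H s) (cell s)" by (rule inj_on_inverseI[of _ k]) (rule homeomorphism_apply1[OF k])
  qed
  have edge: "{a, b} \<in> E \<union> T" if "a \<noteq> b" for a b :: 'v using that by (simp add: E_def)
  have tri: "{a, b, c} \<in> E \<union> T" if "a \<noteq> b" "b \<noteq> c" "a \<noteq> c" for a b c :: 'v using that by (simp add: T_def)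
  define g where "g a b = plane \<circ> H {a, b} \<circ> linepath (vert a) (vert b)" for a b
  have img: "path_image (g a b) = plane ` f ` cell {a, b}" if "a \<noteq> b" for a b
  proof -
    have "path_image (g a b) = plane ` H {a, b} ` path_image (linepath (vert a) (vert b))"
      by (simp add: g_def path_image_def image_comp)
    also have "\<dots> = plane ` H {a, b} ` cell {a, b}" by (simp add: cell_pair)
    finally show ?thesis using Hf[OF edge[OF that]] by simp
  qed
  have H_vert: "H {a, b} (vert a) = f (vert a)" if "a \<noteq> b" for a b
    using Hf[OF edge[OF that], of "{a}"] by (simp add: cell_singleton)
  have arc: "arc (g a b)" if "a \<noteq> b" for a b
  proof -
    have lin: "arc (linepath (vert a) (vert b))" using that by (simp add: arc_linepath vert_eq_iff)
    have im: "linepath (vert a) (vert b) ` {0..1} = cell {a, b}"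
      using path_image_linepath[of "vert a" "vert b"] by (simp add: path_image_def cell_pair)
    have "continuous_on {0..1} (g a b)"
      unfolding g_def
    proof (intro continuous_on_compose continuous_on_linepath continuous_on_plane)
      show "continuous_on (linepath (vert a) (vert b) ` {0..1}) (H {a, b})"
        unfolding im by (rule cont_H[OF edge[OF that]])
    qed
    moreover have "inj_on (g a b) {0..1}"
      unfolding g_def
    proof (intro comp_inj_on)
      show "inj_on (linepath (vert a) (vert b)) {0..1}" using lin by (simp add: arc_def)
      show "inj_on (H {a, b}) (linepath (vert a) (vert b) ` {0..1})"
        unfolding im by (rule inj_H[OF edge[OF that]])
    qed (rule inj_on_subset[OF inj_plane subset_UNIV])
    ultimately show ?thesis by (simp add: arc_def path_def)
  qed
  have loop: "winding_number (g a b +++ g b c +++ g c a) r = 0"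
    if d: "a \<noteq> b" "b \<noteq> c" "a \<noteq> c" and r: "r \<notin> plane ` f ` cell {a, b, c}" for a b c r
  proof -
    let ?t = "{a, b, c}" and ?p = "g a b +++ g b c +++ g c a"
    have ends: "pathstart (g u v) = plane (f (vert u))" "pathfinish (g u v) = plane (f (vert v))" if "u \<noteq> v" for u v
      using H_vert[of u v] H_vert[of v u] that
      by (simp_all add: g_def pathstart_compose pathfinish_compose insert_commute)
    have face: "plane ` f ` cell ?t = (plane \<circ> H ?t) ` cell ?t"
      unfolding image_comp[symmetric] Hf[OF tri[OF d] order_refl] ..
    have "cell ?t homeomorphic plane ` f ` cell ?t"
      unfolding face
    proof (rule homeomorphic_compact)
      show "compact (cell ?t)" by (simp add: cell_def finite_imp_compact_convex_hull)
      show "continuous_on (cell ?t) (plane \<circ> H ?t)"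
        by (intro continuous_on_compose cont_H tri d continuous_on_plane)
      show "inj_on (plane \<circ> H ?t) (cell ?t)"
        by (intro comp_inj_on inj_H tri d) (rule inj_on_subset[OF inj_plane], simp)
    qed simp
    moreover have "simply_connected (cell ?t)"
      by (simp add: cell_def convex_imp_simply_connected)
    ultimately have sc: "simply_connected (plane ` f ` cell ?t)"
      using homeomorphic_simply_connected by blast
    have sub: "path_image (g u v) \<subseteq> plane ` f ` cell ?t" if "u \<noteq> v" "{u, v} \<subseteq> ?t" for u v
      unfolding img[OF that(1)] using cell_mono[OF that(2)] by blast
    have p: "path ?p" "path_image ?p \<subseteq> plane ` f ` cell ?t" "pathfinish ?p = pathstart ?p"
      using d sub[of a b] sub[of b c] sub[of c a]
      by (simp_all add: ends arc arc_imp_path path_image_join)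
    define z where "z = plane (f (vert a))"
    have z: "z \<in> plane ` f ` cell ?t"
      unfolding z_def cell_def by (intro imageI hull_inc) simp
    have "homotopic_loops (plane ` f ` cell ?t) ?p (linepath z z)"
      using sc p z unfolding simply_connected_eq_contractible_loop_any by blast
    then have "homotopic_loops (- {r}) ?p (linepath z z)"
      by (rule homotopic_loops_subset) (use r in blast)
    then have "winding_number ?p r = winding_number (linepath z z) r"
      by (rule winding_number_homotopic_loops)
    moreover have "z \<noteq> r" using z r by blast
    ultimately show ?thesis by simp
  qed
  have "complete_drawing (\<lambda>v. plane (f (vert v))) g (\<lambda>t. plane ` f ` cell t)"
  proof
    fix a b c :: 'v
    assume ab: "a \<noteq> b"
    show "arc (g a b)" by (rule arc[OF ab])
    show "pathstart (g a b) = plane (f (vert a))"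
      using H_vert[OF ab] by (simp add: g_def pathstart_compose)
    show "g b a = reversepath (g a b)"
      unfolding g_def insert_commute[of b a "{}"] path_compose_reversepath[symmetric] reversepath_linepath ..
    assume bc: "b \<noteq> c" and ac: "a \<noteq> c"
    show "path_image (g a b) \<inter> path_image (g b c) \<subseteq> {plane (f (vert b))}"
    proof -
      let ?t = "{a, b, c}"
      have t: "?t \<in> E \<union> T" by (rule tri[OF ab bc ac])
      have "path_image (g a b) \<inter> path_image (g b c) = plane ` (H ?t ` cell {a, b} \<inter> H ?t ` cell {b, c})"
        unfolding img[OF ab] img[OF bc] using Hf[OF t, of "{a, b}"] Hf[OF t, of "{b, c}"]
        by (simp add: image_Int[OF inj_plane])
      also have "H ?t ` cell {a, b} \<inter> H ?t ` cell {b, c} = H ?t ` (cell {a, b} \<inter> cell {b, c})"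
        by (rule inj_on_image_Int[OF inj_H[OF t], symmetric]) (intro cell_mono, blast)+
      also have "\<dots> \<subseteq> H ?t ` cell {b}"
        using cells_meet[OF ab bc ac] by (auto simp: cell_singleton)
      also have "H ?t ` cell {b} = {f (vert b)}"
        using Hf[OF t, of "{b}"] by (simp add: cell_singleton)
      finally show ?thesis by (auto simp: image_mono)
    qed
    show "r \<notin> plane ` f ` cell {a, b, c} \<Longrightarrow> winding_number (g a b +++ g b c +++ g c a) r = 0" for r
      by (rule loop[OF ab bc ac])
  qed (use assms(2) in auto)
  then show ?thesis by (rule that)
qed

section \<open>From counting triangles to the weights\<close>

lemma real_choose_two: "real (m choose 2) = real m * (real m - 1) / 2"
proof (induction m)
  case (Suc m)
  have "Suc m choose 2 = m + (m choose 2)" by (simp add: numeral_2_eq_2)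
  with Suc show ?case by (simp add: field_simps)
qed simp

lemma card_ordered_doubletons: "card {(b, v). {b, v} = D} \<le> 2"
proof (cases "\<exists>x y. D = {x, y}")
  case True
  then obtain x y where D: "D = {x, y}" by (elim exE)
  have "card {(b, v). {b, v} = D} \<le> card {(x, y), (y, x)}"
    unfolding D doubleton_eq_iff by (rule card_mono) auto
  also have "\<dots> \<le> 2" using card_length[of "[(x, y), (y, x)]"] by simp
  finally show ?thesis .
next
  case False
  then have "{b, v} \<noteq> D" for b v by metis
  then have "{(b, v). {b, v} = D} = {}" by simp
  then show ?thesis by simp
qed

lemma card_ordered_pairs_le:
  fixes S :: "'v::finite set set"
  shows "card {(b, v). b \<noteq> a \<and> v \<noteq> a \<and> v \<noteq> b \<and> {a, b, v} \<in> S} \<le> 2 * card {t \<in> S. a \<in> t}"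
proof -
  let ?A = "{(b, v). b \<noteq> a \<and> v \<noteq> a \<and> v \<noteq> b \<and> {a, b, v} \<in> S}"
  let ?fibre = "\<lambda>t. {(b, v). {b, v} = t - {a}}"
  have "?A \<subseteq> (\<Union>t\<in>{t \<in> S. a \<in> t}. ?fibre t)"
  proof
    fix e assume "e \<in> ?A"
    moreover obtain b v where e: "e = (b, v)" by (rule prod.exhaust)
    ultimately have bv: "b \<noteq> a" "v \<noteq> a" "{a, b, v} \<in> S" by simp_all
    have "{b, v} = {a, b, v} - {a}" using bv(1,2) by (simp add: insert_Diff_if)
    then have "e \<in> ?fibre {a, b, v}" unfolding e mem_Collect_eq case_prod_conv .
    moreover have "{a, b, v} \<in> {t \<in> S. a \<in> t}" using bv(3) by simp
    ultimately show "e \<in> (\<Union>t\<in>{t \<in> S. a \<in> t}. ?fibre t)" by (rule UN_I[rotated])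
  qed
  then have "card ?A \<le> card (\<Union>t\<in>{t \<in> S. a \<in> t}. ?fibre t)"
    by (rule card_mono[rotated]) (rule finite)
  also have "\<dots> \<le> (\<Sum>t\<in>{t \<in> S. a \<in> t}. card (?fibre t))"
    by (rule card_UN_le) (rule finite)
  also have "\<dots> \<le> (\<Sum>t\<in>{t \<in> S. a \<in> t}. 2)"
    by (rule sum_mono) (rule card_ordered_doubletons)
  finally show ?thesis by (simp add: mult.commute)
qed

text \<open>
  Choosing a triangle with probability \<open>weight p t\<close> amounts to choosing a vertex from \<open>p\<close> and then
  two further vertices uniformly: there are \<open>(n - 1) choose 2\<close> triangles at each vertex.
\<close>
lemma sum_weight_eq:
  fixes p :: "'v::finite pmf"
  assumes "S \<subseteq> T"
  shows "(\<Sum>t\<in>S. weight p t) = (\<Sum>a\<in>UNIV. pmf p a * (card {t \<in> S. a \<in> t} / ((CARD('v) - 1) choose 2)))"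
proof -
  let ?C = "real ((CARD('v) - 1) choose 2)"
  have "(\<Sum>t\<in>S. weight p t) = (\<Sum>t\<in>S. \<Sum>a\<in>UNIV. if a \<in> t then pmf p a / ?C else 0)"
  proof (rule sum.cong[OF refl])
    fix t assume "t \<in> S"
    then have "card t - 1 = 2" using assms by (auto simp: T_def)
    then show "weight p t = (\<Sum>a\<in>UNIV. if a \<in> t then pmf p a / ?C else 0)"
      by (simp add: weight_def sum.If_cases sum_divide_distrib)
  qed
  also have "\<dots> = (\<Sum>a\<in>UNIV. \<Sum>t\<in>S. if a \<in> t then pmf p a / ?C else 0)" by (rule sum.swap)
  also have "\<dots> = (\<Sum>a\<in>UNIV. pmf p a * (card {t \<in> S. a \<in> t} / ?C))"
    by (simp add: sum.If_cases Int_def mult.commute)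
  finally show ?thesis .
qed

text \<open>
  Here \<open>m = n - 1\<close> and \<open>N\<close> is the number of triangles at a vertex that contain the point.  The constant
  \<open>15/52\<close> is below the tolerance \<open>1/3\<close>, and large enough for the resulting density to reach the
  required bound for all \<open>m \<ge> 4\<close>.
\<close>
lemma density_arith:
  fixes m N :: real
  assumes "4 \<le> m" and "15/52 < 1 / m + 4 * N / m^2"
  shows "1/13 - 3 / (13 * m) \<le> N / (m * (m - 1) / 2)"
proof -
  have "15/52 * (52 * m^2) < (1 / m + 4 * N / m^2) * (52 * m^2)"
    using assms by (intro mult_strict_right_mono) auto
  also have "\<dots> = 52 * m + 208 * N"
    using assms(1) by (simp add: distrib_right power2_eq_square)
  finally have "15 * m^2 < 52 * m + 208 * N" by simp
  moreover have "0 \<le> (m - 4) * (7 * m + 8) + 8" using assms(1) by (intro add_nonneg_nonneg mult_nonneg_nonneg) auto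
  ultimately have "(m - 3) * (m - 1) \<le> 26 * N" by (simp add: algebra_simps power2_eq_square)
  then have "(m - 3) * (m - 1) / (13 * m * (m - 1)) \<le> 26 * N / (13 * m * (m - 1))"
    using assms(1) by (intro divide_right_mono) auto
  also have "26 * N / (13 * m * (m - 1)) = N / (m * (m - 1) / 2)" by simp
  also have "(m - 3) * (m - 1) / (13 * m * (m - 1)) = 1/13 - 3 / (13 * m)"
    using assms(1) by (simp add: diff_divide_distrib)
  finally show ?thesis .
qed

theorem theorem2:
  fixes f :: "real ^ 'v::finite \<Rightarrow> real ^ 2" and p :: "'v pmf" and n :: nat
  assumes "CARD('v) = n" and "n \<ge> 2"
    and "continuous_on X f"
    and "simplicial_images f"
    and "\<And>e. e \<in> E \<Longrightarrow> f ` cell e \<subseteq> cball 0 (1/2)"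
    and "well_behaved f"
  shows "\<exists>r::real ^ 2. (\<Sum>t | t \<in> T \<and> r \<in> f ` cell t. weight p t) \<ge> 1/13 - 3 / (13 * (real n - 1))"
proof (cases "n < 5")
  case True
  have "1/13 - 3 / (13 * (real n - 1)) \<le> 0"
  proof -
    have "0 < real n - 1" "real n - 1 \<le> 3" using True \<open>n \<ge> 2\<close> by auto
    then show ?thesis by (simp add: le_divide_eq)
  qed
  also have "\<dots> \<le> (\<Sum>t | t \<in> T \<and> 0 \<in> f ` cell t. weight p t)"
    by (intro sum_nonneg) (simp add: weight_def sum_nonneg)
  finally show ?thesis by blast
next
  case False
  define m where "m = real (CARD('v) - 1)"
  have m: "m = real n - 1" "4 \<le> m" using False assms(1) by (auto simp: m_def)
  have card3: "3 \<le> CARD('v)" using False assms(1) by simp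
  let ?q = "\<lambda>v. plane (f (vert v))"
  obtain g where "complete_drawing ?q g (\<lambda>t. plane ` f ` cell t)"
    by (rule simplicial_images_drawing[OF assms(4) card3])
  then interpret complete_drawing ?q g "\<lambda>t. plane ` f ` cell t" .
  obtain share where "weighted_drawing ?q g (\<lambda>t. plane ` f ` cell t) share"
  proof (rule vanishing_weights[OF inj_q])
    fix share :: "'v \<Rightarrow> complex \<Rightarrow> real"
    assume "\<And>v r. 0 \<le> share v r" "\<And>v r. share v r \<le> 1 / real (CARD('v) - 1)"
      "\<And>r. (\<Sum>v\<in>UNIV. share v r) = 1" "\<And>v x. isCont (share v) x"
      "\<And>v. \<forall>\<^sub>F r in nhds (?q v). share v r = 0"
    then have "weighted_drawing ?q g (\<lambda>t. plane ` f ` cell t) share" by unfold_locales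
    then show thesis by (rule that)
  qed (use card3 in simp)
  then interpret weighted_drawing ?q g "\<lambda>t. plane ` f ` cell t" share .
  have less: "(15/52 :: real) < 1/3" by simp
  obtain r' where r': "\<And>a. 15/52 < 1 / m + 2 * real (card (covering_pairs a r')) / m^2"
  proof (rule deep_point[OF less])
    fix r assume "\<And>a. 15/52 < 1 / real (CARD('v) - 1) + 2 * real (card (covering_pairs a r)) / real (CARD('v) - 1)^2"
    then show thesis unfolding m_def[symmetric] by (rule that)
  qed
  obtain r where r: "r' = plane r" by (rule surjE[OF surj_plane])
  define S where "S = {t \<in> T. r \<in> f ` cell t}"
  let ?C = "real ((CARD('v) - 1) choose 2)"
  have C: "?C = m * (m - 1) / 2" unfolding m_def by (rule real_choose_two)
  have key: "1/13 - 3 / (13 * m) \<le> card {t \<in> S. a \<in> t} / ?C" for a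
  proof -
    define N where "N = real (card {t \<in> S. a \<in> t})"
    have "covering_pairs a r' = {(b, v). b \<noteq> a \<and> v \<noteq> a \<and> v \<noteq> b \<and> {a, b, v} \<in> S}"
      unfolding covering_pairs_def S_def r by (auto simp: T_def inj_image_mem_iff[OF inj_plane])
    then have "card (covering_pairs a r') \<le> 2 * card {t \<in> S. a \<in> t}"
      using card_ordered_pairs_le[of a S] by simp
    then have "2 * real (card (covering_pairs a r')) / m^2 \<le> 4 * N / m^2"
      unfolding N_def by (intro divide_right_mono) auto
    then have "15/52 < 1 / m + 4 * N / m^2" using r'[of a] by linarith
    then show ?thesis unfolding C N_def[symmetric] by (rule density_arith[OF m(2)])
  qed
  have "1/13 - 3 / (13 * m) = (\<Sum>a\<in>UNIV. pmf p a * (1/13 - 3 / (13 * m)))"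
    unfolding sum_distrib_right[symmetric] using sum_pmf_eq_1[of UNIV p] by simp
  also have "\<dots> \<le> (\<Sum>a\<in>UNIV. pmf p a * (card {t \<in> S. a \<in> t} / ?C))"
    by (intro sum_mono mult_left_mono key) simp
  also have "\<dots> = (\<Sum>t\<in>S. weight p t)" by (rule sum_weight_eq[symmetric]) (simp add: S_def)
  finally show ?thesis unfolding S_def m(1) by (rule exI)
qed

end
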